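(* Let $\bar{s}$ (offline, random access) and $s$ (online, streamed) be strings of length $n$, where $n$ is a perfect square, and let $\epsilon^*>0$. Let $K=\lfloor\log_{1+\epsilon^*} n\rfloor$ and $f(k)=\lfloor(1+\epsilon^* )^k\rfloor$. Consider the algorithm that splits $s$ into $\sqrt{n}$ consecutive windows $s^*_i=s[(i-1)\sqrt{n}+1,\,i\sqrt{n}]$, keeps an array $D[0..K]$ initialized to $\infty$, and upon the arrival of each window $s^*_i$ (stored in memory) computes a new array $T$ by setting, for each $0\le k\le K$, $$T[k]=\min\Big\{\mathrm{lcsp}_{(i-1)\sqrt{n}+1,\,i\sqrt{n}}\big(1,f(k)\big),\ \min_{\substack{0\le k_1\le k\\ D[k_1]<\infty}}\mathrm{lcsp}_{(i-1)\sqrt{n}+1,\,i\sqrt{n}}\big(D[k_1]+1,\,f(k)-f(k_1)\big)\Big\},$$ and then replaces $D$ by $T$; at the end it returns the largest value $f(k)$ with $D[k]<\infty$, or $0$ if there is none. This algorithm returns a $(1-\epsilon^* )^{\sqrt{n}}$-approximation of $\mathrm{lcs}(\bar{s},s)$ (its output is at least $(1-\epsilon^* )^{\sqrt{n}}\cdot\mathrm{lcs}(\bar{s},s)$) and uses $\tilde{O}(\sqrt{n}+\log_{1+\epsilon^*} n)$ memory.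
   Context: For a string $x$, $x[i,j]$ denotes the substring from the $i$-th to the $j$-th character (empty if $j<i$). $\mathrm{lcs}(x,y)$ is the length of a longest common subsequence. For $1\le l\le r\le n$, a position $p$ and an integer $k\ge 1$, $\mathrm{lcsp}_{l,r}(p,k)$ is the smallest position $q$ with $\mathrm{lcs}(\bar{s}[p,q],s[l,r])\ge k$, or $\infty$ if none exists; $\mathrm{lcsp}_{l,r}(p,0)=p-1$. $\tilde{O}$ hides polylogarithmic factors in $n$.
   Formalization: The approximation claim is proved for ε* ≤ 1 and, if s̄ = s, only when (1-ε* )^{√n}·n ≤ f(K); without these it fails (n=4, s̄=s, ε*=1/8 or ε*=2). The memory bound is for n ≥ 2 and all ε* > 0, with the table of f given in charged memory. *)

theory Defs
  imports Complex_Main "HOL-Library.Sublist" "HOL-Library.Extended_Nat" "HOL-Library.Log_Nat"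
begin

section \<open>Strings\<close>

text \<open>Positions are 1-based.\<close>

definition substr :: "'a list \<Rightarrow> nat \<Rightarrow> nat \<Rightarrow> 'a list" where
  "substr x i j = take (j + 1 - i) (drop (i - 1) x)"

definition lcs :: "'a list \<Rightarrow> 'a list \<Rightarrow> nat" where
  "lcs x y = Max {length z | z. subseq z x \<and> subseq z y}"

text \<open>The infimum of the empty set of extended naturals is \<open>\<infinity>\<close>.\<close>

definition lcsp :: "'a list \<Rightarrow> 'a list \<Rightarrow> nat \<Rightarrow> nat \<Rightarrow> nat \<Rightarrow> nat \<Rightarrow> enat" where
  "lcsp sbar s l r p k =
     (if k = 0 then enat (p - 1)
      else Inf {enat q | q. 1 \<le> q \<and> q \<le> length sbar \<and> k \<le> lcs (substr sbar p q) (substr s l r)})"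


section \<open>The algorithm\<close>

definition K_max :: "real \<Rightarrow> nat \<Rightarrow> nat" where
  "K_max \<epsilon> n = nat \<lfloor>log (1 + \<epsilon>) (real n)\<rfloor>"

definition f_val :: "real \<Rightarrow> nat \<Rightarrow> nat" where
  "f_val \<epsilon> k = nat \<lfloor>(1 + \<epsilon>) ^ k\<rfloor>"

definition new_array ::
    "real \<Rightarrow> 'a list \<Rightarrow> 'a list \<Rightarrow> nat \<Rightarrow> nat \<Rightarrow> (nat \<Rightarrow> enat) \<Rightarrow> (nat \<Rightarrow> enat)" where
  "new_array \<epsilon> sbar s l r D = (\<lambda>k.
     min (lcsp sbar s l r 1 (f_val \<epsilon> k))
         (Inf {lcsp sbar s l r (the_enat (D k1) + 1) (f_val \<epsilon> k - f_val \<epsilon> k1) | k1.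
                 k1 \<le> k \<and> D k1 < \<infinity>}))"

text \<open>
  \<open>D_array \<epsilon> m sbar s i\<close> is the array after \<open>i\<close> windows of length \<open>m\<close>. Its entry \<open>k\<close> depends on
  entries \<open>k1 \<le> k\<close> only, so it is given for all \<open>k\<close>; the algorithm keeps those with
  \<open>k \<le> K_max \<epsilon> n\<close>.
\<close>

fun D_array :: "real \<Rightarrow> nat \<Rightarrow> 'a list \<Rightarrow> 'a list \<Rightarrow> nat \<Rightarrow> (nat \<Rightarrow> enat)" where
  "D_array \<epsilon> m sbar s 0 = (\<lambda>k. \<infinity>)"
| "D_array \<epsilon> m sbar s (Suc i) =
     new_array \<epsilon> sbar s (i * m + 1) (Suc i * m) (D_array \<epsilon> m sbar s i)"

definition alg_output :: "real \<Rightarrow> nat \<Rightarrow> 'a list \<Rightarrow> 'a list \<Rightarrow> nat" where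
  "alg_output \<epsilon> m sbar s =
     (let F = {k. k \<le> K_max \<epsilon> (length s) \<and> D_array \<epsilon> m sbar s m k < \<infinity>}
      in if F = {} then 0 else Max (f_val \<epsilon> ` F))"


section \<open>Programs with read-only random access to one string and a one-way stream\<close>

text \<open>
  The working memory is a list of growing arrays whose cells hold a natural number or a
  character. A number is charged its binary length (plus one), a character one unit. Neither the
  offline string nor the part of the stream that is not stored is charged. Characters can only be
  copied and compared, so that nothing can be hidden in them even if the alphabet is infinite.
\<close>

datatype 'a cell = Num nat | Chr 'a

type_synonym 'a store = "'a cell list list"

fun cell_size :: "'a cell \<Rightarrow> nat" where
  "cell_size (Num v) = 1 + floorlog 2 v"
| "cell_size (Chr c) = 1"

definition memory :: "'a store \<Rightarrow> nat" where
  "memory M = (\<Sum>A\<leftarrow>M. \<Sum>v\<leftarrow>A. cell_size v)"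

datatype aexp = Const nat | Cell nat aexp | Offline aexp | Plus aexp aexp | Minus aexp aexp

datatype bexp = Eq aexp aexp | Less aexp aexp | Neg bexp | Conj bexp bexp

text \<open>\<open>None\<close> signals an access out of bounds or a type error.\<close>

fun aval :: "'a list \<Rightarrow> 'a store \<Rightarrow> aexp \<Rightarrow> 'a cell option" where
  "aval sbar M (Const v) = Some (Num v)"
| "aval sbar M (Cell a e) =
     (case aval sbar M e of
        Some (Num i) \<Rightarrow> if a < length M \<and> i < length (M ! a) then Some (M ! a ! i) else None
      | _ \<Rightarrow> None)"
| "aval sbar M (Offline e) =
     (case aval sbar M e of
        Some (Num p) \<Rightarrow> if 1 \<le> p \<and> p \<le> length sbar then Some (Chr (sbar ! (p - 1))) else None
      | _ \<Rightarrow> None)"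
| "aval sbar M (Plus e1 e2) =
     (case (aval sbar M e1, aval sbar M e2) of
        (Some (Num u), Some (Num v)) \<Rightarrow> Some (Num (u + v))
      | _ \<Rightarrow> None)"
| "aval sbar M (Minus e1 e2) =
     (case (aval sbar M e1, aval sbar M e2) of
        (Some (Num u), Some (Num v)) \<Rightarrow> Some (Num (u - v))
      | _ \<Rightarrow> None)"

fun bval :: "'a list \<Rightarrow> 'a store \<Rightarrow> bexp \<Rightarrow> bool option" where
  "bval sbar M (Eq e1 e2) =
     (case (aval sbar M e1, aval sbar M e2) of
        (Some u, Some v) \<Rightarrow> Some (u = v)
      | _ \<Rightarrow> None)"
| "bval sbar M (Less e1 e2) =
     (case (aval sbar M e1, aval sbar M e2) of
        (Some (Num u), Some (Num v)) \<Rightarrow> Some (u < v)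
      | _ \<Rightarrow> None)"
| "bval sbar M (Neg b) = map_option Not (bval sbar M b)"
| "bval sbar M (Conj b1 b2) =
     (case bval sbar M b1 of
        Some True \<Rightarrow> bval sbar M b2
      | r \<Rightarrow> r)"

text \<open>Writing just behind the end of an array makes it longer by one cell.\<close>

definition put_cell :: "'a store \<Rightarrow> nat \<Rightarrow> nat \<Rightarrow> 'a cell \<Rightarrow> 'a store option" where
  "put_cell M a i v =
     (if a < length M \<and> i < length (M ! a) then Some (M[a := (M ! a)[i := v]])
      else if a < length M \<and> i = length (M ! a) then Some (M[a := M ! a @ [v]])
      else None)"

text \<open>\<open>Next a e\<close> moves the next character of the stream into a cell.\<close>

datatype com =
    Skip
  | Put nat aexp aexp
  | Next nat aexp
  | Seq com com
  | Cond bexp com com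
  | While bexp com

text \<open>
  A configuration is the working memory together with the number of characters of the stream
  consumed so far. \<open>exec sbar s c x t y\<close>: started in \<open>x\<close>, the program \<open>c\<close> terminates in \<open>y\<close>
  without error, and \<open>t\<close> lists all configurations entered on the way.
\<close>

type_synonym 'a config = "'a store \<times> nat"

inductive exec ::
    "'a list \<Rightarrow> 'a list \<Rightarrow> com \<Rightarrow> 'a config \<Rightarrow> 'a config list \<Rightarrow> 'a config \<Rightarrow> bool"
  for sbar s :: "'a list" where
  Skip: "exec sbar s Skip x [] x"
| Put: "aval sbar M e = Some (Num i) \<Longrightarrow> aval sbar M e' = Some v \<Longrightarrow> put_cell M a i v = Some M' \<Longrightarrow>
    exec sbar s (Put a e e') (M, pos) [(M', pos)] (M', pos)"
| Next: "aval sbar M e = Some (Num i) \<Longrightarrow> pos < length s \<Longrightarrow> put_cell M a i (Chr (s ! pos)) = Some M' \<Longrightarrow>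
    exec sbar s (Next a e) (M, pos) [(M', Suc pos)] (M', Suc pos)"
| Seq: "exec sbar s c x t y \<Longrightarrow> exec sbar s c' y t' z \<Longrightarrow> exec sbar s (Seq c c') x (t @ t') z"
| CondTrue: "bval sbar (fst x) b = Some True \<Longrightarrow> exec sbar s c x t y \<Longrightarrow>
    exec sbar s (Cond b c c') x t y"
| CondFalse: "bval sbar (fst x) b = Some False \<Longrightarrow> exec sbar s c' x t y \<Longrightarrow>
    exec sbar s (Cond b c c') x t y"
| WhileFalse: "bval sbar (fst x) b = Some False \<Longrightarrow> exec sbar s (While b c) x [] x"
| WhileTrue: "bval sbar (fst x) b = Some True \<Longrightarrow> exec sbar s c x t y \<Longrightarrow>
    exec sbar s (While b c) y t' z \<Longrightarrow> exec sbar s (While b c) x (t @ t') z"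


section \<open>Implementations of the algorithm\<close>

text \<open>
  The parameters \<open>n\<close>, \<open>\<surd>n\<close>, \<open>K\<close> and the table of \<open>f\<close> (a real \<open>\<epsilon>\<close> does not fit into a cell) are
  supplied in arrays 0 to 3 and are charged. Arrays 4 and 5 are reserved for \<open>D\<close> and for the
  output; \<open>d\<close> further arrays are at the disposal of the program.
\<close>

definition initial_store :: "real \<Rightarrow> nat \<Rightarrow> nat \<Rightarrow> nat \<Rightarrow> 'a store" where
  "initial_store \<epsilon> n m d =
     [[Num n], [Num m], [Num (K_max \<epsilon> n)], map (\<lambda>k. Num (f_val \<epsilon> k)) [0..<Suc (K_max \<epsilon> n)],
      [], []] @ replicate d []"

text \<open>Finite entries of \<open>D\<close> are positions, hence at least 1, and 0 is free to represent \<open>\<infinity>\<close>.\<close>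

fun entry_cell :: "enat \<Rightarrow> 'a cell" where
  "entry_cell (enat q) = Num q"
| "entry_cell \<infinity> = Num 0"

text \<open>
  The program terminates with the output of the algorithm, it goes through the arrays \<open>D\<close> of the
  algorithm (the one for \<open>i\<close> windows being in memory when exactly \<open>i\<close> windows have arrived), and its
  memory never exceeds \<open>B\<close>.
\<close>

definition implements_within ::
    "com \<Rightarrow> nat \<Rightarrow> real \<Rightarrow> nat \<Rightarrow> 'a list \<Rightarrow> 'a list \<Rightarrow> real \<Rightarrow> bool" where
  "implements_within P d \<epsilon> m sbar s B \<longleftrightarrow>
     (let n = length s; x = (initial_store \<epsilon> n m d, 0) in
      \<exists>t y. exec sbar s P x t y \<and>
        fst y ! 5 = [Num (alg_output \<epsilon> m sbar s)] \<and>
        (\<forall>i\<le>m. \<exists>z \<in> set t. snd z = i * m \<and>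
           fst z ! 4 = map (\<lambda>k. entry_cell (D_array \<epsilon> m sbar s i k)) [0..<Suc (K_max \<epsilon> n)]) \<and>
        (\<forall>z \<in> set (x # t). real (memory (fst z)) \<le> B))"


section \<open>Parameters for which the approximation guarantee fails\<close>

text \<open>
  No output exceeds \<open>f K\<close>, which may be smaller than \<open>n\<close>. So for \<open>sbar = s\<close> the guarantee
  \<open>(1 - \<epsilon>) ^ \<surd>n * n\<close> is out of reach if \<open>\<epsilon>\<close> is too small, or if \<open>\<epsilon> > 1\<close>, where the
  powers of \<open>1 - \<epsilon>\<close> alternate in sign.
\<close>

lemma f_val_mono:
  assumes "0 < \<epsilon>" "j \<le> k" shows "f_val \<epsilon> j \<le> f_val \<epsilon> k"
  unfolding f_val_def using assms by (intro nat_mono floor_mono power_increasing) auto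

lemma alg_output_le:
  assumes "0 < \<epsilon>" shows "alg_output \<epsilon> m sbar s \<le> f_val \<epsilon> (K_max \<epsilon> (length s))"
  unfolding alg_output_def Let_def using f_val_mono[OF assms] by (auto intro!: Max.boundedI)

lemma lcs_self: "lcs x x = length x"
proof -
  have sub: "{length z | z. subseq z x \<and> subseq z x} \<subseteq> {..length x}"
    by (auto dest: list_emb_length)
  show ?thesis unfolding lcs_def
    by (rule Max_eqI) (use sub finite_subset[OF sub] in auto)
qed

lemma K_max_eqI:
  assumes "0 < \<epsilon>" "0 < n" "(1 + \<epsilon>) ^ k \<le> real n" "real n < (1 + \<epsilon>) ^ Suc k"
  shows "K_max \<epsilon> n = k"
proof -
  have "real k \<le> log (1 + \<epsilon>) n" "log (1 + \<epsilon>) n < real (Suc k)"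
    using assms by (simp_all add: le_log_iff log_less_iff powr_realpow del: power_Suc of_nat_Suc)
  then have "\<lfloor>log (1 + \<epsilon>) n\<rfloor> = int k" by (intro floor_unique) auto
  then show ?thesis by (simp add: K_max_def)
qed

lemma guarantee_fails_small_eps:
  assumes "length s = 4"
  shows "real (alg_output (1/8) 2 s s) < (1 - 1/8) ^ 2 * real (lcs s s)"
proof -
  have "K_max (1/8) 4 = 11" by (rule K_max_eqI) (simp_all add: power_divide)
  moreover have "f_val (1/8) 11 = 3" by (simp add: f_val_def power_divide)
  ultimately have "alg_output (1/8) 2 s s \<le> 3"
    using alg_output_le[of "1/8" 2 s s] assms by simp
  then have "real (alg_output (1/8) 2 s s) \<le> 3" by linarith
  then show ?thesis by (simp add: lcs_self assms power2_eq_square)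
qed

lemma guarantee_fails_large_eps:
  assumes "length s = 4"
  shows "real (alg_output 2 2 s s) < (1 - 2) ^ 2 * real (lcs s s)"
proof -
  have "K_max 2 4 = 1" by (rule K_max_eqI) simp_all
  moreover have "f_val 2 1 = 3" by (simp add: f_val_def)
  ultimately have "alg_output 2 2 s s \<le> 3"
    using alg_output_le[of 2 2 s s] assms by simp
  then show ?thesis by (simp add: lcs_self assms)
qed

end

theory Submission
  imports Defs
begin

text \<open>
  Approximation. Cut a longest common subsequence at the window boundaries. By induction on the
  number \<open>i\<close> of windows, for every nonempty common subsequence \<open>z\<close> of the first \<open>i\<close> windows and the
  first \<open>q\<close> offline characters some \<open>k\<close> satisfies \<open>D[k] \<le> q\<close> and
  \<open>(1 - \<epsilon>)^i |z| \<le> f k \<le> |z|\<close>: each window costs only one rounding to a value of \<open>f\<close>, hence one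
  factor \<open>1 - \<epsilon>\<close>. An index above \<open>K\<close> can arise only if \<open>z\<close> has length \<open>n\<close>, that is, if both
  strings are equal.

  Memory. Entry \<open>k\<close> of the new array depends only on entries \<open>k1 \<le> k\<close> of the old one, so \<open>D\<close> is
  updated in place for decreasing \<open>k\<close>. A value of \<open>lcsp\<close> is found by running over the offline string
  while keeping a single row of the dynamic program for \<open>lcs\<close> against the stored window. Only \<open>O(1)\<close>
  arrays of length \<open>O(\<surd>n + K)\<close> are needed, with entries at most \<open>n\<close>, and \<open>O(1)\<close> counters bounded by
  \<open>n + K + 3\<close>.
\<close>

section \<open>Longest common subsequences\<close>

lemma finite_common_subseq_lengths: "finite {length z | z. subseq z x \<and> subseq z y}"
  by (rule finite_subset[of _ "{..length x}"]) (auto dest: list_emb_length)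

lemma length_le_lcs: "subseq z x \<Longrightarrow> subseq z y \<Longrightarrow> length z \<le> lcs x y"
  unfolding lcs_def by (rule Max_ge[OF finite_common_subseq_lengths]) auto

lemma lcs_witness: obtains z where "subseq z x" "subseq z y" "length z = lcs x y"
proof -
  have "lcs x y \<in> {length z | z. subseq z x \<and> subseq z y}"
    unfolding lcs_def by (rule Max_in[OF finite_common_subseq_lengths]) (auto intro!: exI[of _ "[]"])
  then show thesis using that by auto
qed

lemma lcs_mono: "subseq x x' \<Longrightarrow> subseq y y' \<Longrightarrow> lcs x y \<le> lcs x' y'"
  by (metis lcs_witness length_le_lcs subseq_order.trans)

lemma lcs_le_length: "lcs x y \<le> length x" "lcs x y \<le> length y"
  by (metis lcs_witness list_emb_length)+

lemma lcs_Nil [simp]: "lcs [] y = 0" "lcs x [] = 0"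
  using lcs_le_length[of "[]" y] lcs_le_length[of x "[]"] by auto

lemma subseq_snoc_iff: "subseq z (xs @ [a]) \<longleftrightarrow> subseq z xs \<or> (\<exists>z'. z = z' @ [a] \<and> subseq z' xs)"
proof
  assume "subseq z (xs @ [a])"
  then obtain z1 z2 where z: "z = z1 @ z2" "subseq z1 xs" "subseq z2 [a]"
    by (auto simp: subseq_append_iff)
  have "z2 = [] \<or> z2 = [a]" using z(3) by (cases z2) (auto elim: list_emb.cases split: if_splits)
  then show "subseq z xs \<or> (\<exists>z'. z = z' @ [a] \<and> subseq z' xs)" using z by auto
qed (auto intro: subseq_order.trans)

text \<open>Recurrence of the dynamic program, stated at the right ends because both the offline
  piece and the window prefix grow there. If \<open>a = b\<close>, deleting the last character of a
  common subsequence leaves one of \<open>xs\<close> and \<open>ys\<close>; if not, the last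
  character of \<open>z\<close> cannot be matched to both \<open>a\<close> and
  \<open>b\<close>.\<close>

lemma lcs_snoc:
  "lcs (xs @ [a]) (ys @ [b]) =
    (if a = b then Suc (lcs xs ys) else max (lcs (xs @ [a]) ys) (lcs xs (ys @ [b])))"
proof (rule antisym)
  obtain z where z: "subseq z (xs @ [a])" "subseq z (ys @ [b])" "length z = lcs (xs @ [a]) (ys @ [b])"
    by (rule lcs_witness)
  show "lcs (xs @ [a]) (ys @ [b]) \<le>
    (if a = b then Suc (lcs xs ys) else max (lcs (xs @ [a]) ys) (lcs xs (ys @ [b])))"
  proof (cases "a = b")
    case True
    \<comment> \<open>An optimal \<open>z\<close> need not use the new character;
      \<open>butlast z\<close> embeds in the shorter string in either case.\<close>
    have "subseq (butlast z) xs \<and> subseq (butlast z) ys"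
    proof -
      have "subseq (butlast z) w" if "subseq z (w @ [c])" for w c
      proof -
        have "subseq (butlast z) z"
          by (rule prefix_imp_subseq[OF prefixeq_butlast])
        then show ?thesis using that by (auto simp: subseq_snoc_iff)
      qed
      then show ?thesis using z by blast
    qed
    then have "length (butlast z) \<le> lcs xs ys" using length_le_lcs by blast
    then show ?thesis using True z(3) by simp
  next
    case False
    then have "subseq z xs \<or> subseq z ys" using z(1,2) by (auto simp: subseq_snoc_iff)
    then have "length z \<le> lcs (xs @ [a]) ys \<or> length z \<le> lcs xs (ys @ [b])"
      using z length_le_lcs by blast
    then show ?thesis using False z(3) by auto
  qed
next
  obtain z where z: "subseq z xs" "subseq z ys" "length z = lcs xs ys"
    by (rule lcs_witness)
  have "length (z @ [a]) \<le> lcs (xs @ [a]) (ys @ [b])" if "a = b"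
    using that z by (intro length_le_lcs) (auto simp: subseq_snoc_iff)
  moreover have "lcs (xs @ [a]) ys \<le> lcs (xs @ [a]) (ys @ [b])" "lcs xs (ys @ [b]) \<le> lcs (xs @ [a]) (ys @ [b])"
    by (auto intro!: lcs_mono)
  ultimately show "(if a = b then Suc (lcs xs ys) else max (lcs (xs @ [a]) ys) (lcs xs (ys @ [b])))
    \<le> lcs (xs @ [a]) (ys @ [b])" using z(3) by auto
qed

section \<open>Substrings and the function \<open>lcsp\<close>\<close>

lemma substr_Suc: "substr x (Suc c) q = drop c (take q x)"
  by (simp add: substr_def drop_take)

text \<open>Start positions have the form \<open>Suc c\<close>, where \<open>c\<close> offline
  characters are already used, so that the subtraction \<open>p - 1\<close> is exact.
  \<open>c \<le> q\<close> is what the case \<open>k = 0\<close> asks for, since \<open>lcsp\<close>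
  is then \<open>c\<close>.\<close>

lemma lcsp_leI:
  assumes "c \<le> q" "q \<le> length sbar" "k \<le> lcs (substr sbar (Suc c) q) (substr s l r)"
  shows "lcsp sbar s l r (Suc c) k \<le> enat q"
proof (cases "k = 0")
  case False
  then have "1 \<le> q" using assms(3) by (cases q) (auto simp: substr_Suc)
  with False show ?thesis using assms unfolding lcsp_def by (auto intro!: Inf_lower)
qed (use assms in \<open>simp add: lcsp_def\<close>)

lemma enat_Inf_mem: "(A :: enat set) \<noteq> {} \<Longrightarrow> Inf A \<in> A"
  unfolding Inf_enat_def by (auto intro: LeastI)

text \<open>For \<open>k > 0\<close> the infimum is attained because it is finite; for
  \<open>k = 0\<close> the value is \<open>c\<close>, whence the bound on \<open>c\<close>.\<close>

lemma lcsp_enatD: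
  assumes "lcsp sbar s l r (Suc c) k = enat q" "c \<le> length sbar"
  shows "c \<le> q" "q \<le> length sbar" "k \<le> lcs (substr sbar (Suc c) q) (substr s l r)"
proof -
  have "c \<le> q \<and> q \<le> length sbar \<and> k \<le> lcs (substr sbar (Suc c) q) (substr s l r)"
  proof (cases "k = 0")
    case False
    let ?S = "{enat q | q. 1 \<le> q \<and> q \<le> length sbar \<and> k \<le> lcs (substr sbar (Suc c) q) (substr s l r)}"
    have eq: "Inf ?S = enat q" using False assms by (simp add: lcsp_def)
    then have "?S \<noteq> {}" by (metis Inf_empty enat.distinct(2) top_enat_def)
    then have "Inf ?S \<in> ?S" by (rule enat_Inf_mem)
    then have q: "q \<le> length sbar" "k \<le> lcs (substr sbar (Suc c) q) (substr s l r)"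
      using eq by auto
    \<comment> \<open>Below \<open>c\<close> the substring is empty and could not reach a positive
      target.\<close>
    have "c \<le> q" using False q(2) by (rule_tac ccontr) (simp add: substr_Suc)
    with q show ?thesis by simp
  qed (use assms in \<open>auto simp: lcsp_def\<close>)
  then show "c \<le> q" "q \<le> length sbar" "k \<le> lcs (substr sbar (Suc c) q) (substr s l r)" by auto
qed

lemma lcsp_antimono:
  assumes "j \<le> k" "c \<le> length sbar"
  shows "lcsp sbar s l r (Suc c) j \<le> lcsp sbar s l r (Suc c) k"
  using assms lcsp_enatD[of sbar s l r c k] lcsp_leI[of c _ sbar j s l r]
  by (cases "lcsp sbar s l r (Suc c) k") auto

section \<open>The approximation guarantee\<close>

text \<open>Removes the floor, so that estimates of \<open>f\<close> become estimates of powers of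
  \<open>1 + \<epsilon>\<close>.\<close>

lemma f_val_le_iff: "0 < \<epsilon> \<Longrightarrow> f_val \<epsilon> k \<le> v \<longleftrightarrow> (1 + \<epsilon>) ^ k < real v + 1"
  unfolding f_val_def by (simp add: nat_le_iff floor_le_iff)

lemma f_val_0 [simp]: "f_val \<epsilon> 0 = 1" by (simp add: f_val_def)

lemma f_val_pos: "0 < \<epsilon> \<Longrightarrow> 1 \<le> f_val \<epsilon> k"
  using f_val_mono[of \<epsilon> 0 k] by simp

text \<open>
  If \<open>\<epsilon> v < 1\<close>, then \<open>f\<close> does not skip \<open>v\<close>; otherwise the room between \<open>1 / (1 + \<epsilon>)\<close> and
  \<open>1 - \<epsilon>\<close> makes up for the rounding in \<open>f\<close>.
\<close>

lemma f_val_round_down: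
  assumes "0 < \<epsilon>" "1 \<le> v"
  obtains k where "f_val \<epsilon> k \<le> v" "(1 - \<epsilon>) * real v \<le> real (f_val \<epsilon> k)"
    "\<And>j. f_val \<epsilon> j \<le> v \<Longrightarrow> j \<le> k"
proof -
  obtain b where "real v + 1 < (1 + \<epsilon>) ^ b" using real_arch_pow[of "1 + \<epsilon>" "real v + 1"] assms by auto
  then have b: "\<not> f_val \<epsilon> b \<le> v" using assms by (simp add: f_val_le_iff)
  have bound: "j \<le> b" if "f_val \<epsilon> j \<le> v" for j
    using b that f_val_mono[OF assms(1), of b j] by linarith
  \<comment> \<open>\<open>f_val\<close> can repeat values. The greatest index gives both that
    \<open>f_val\<close> exceeds \<open>v\<close> at \<open>Suc k\<close> and the third conclusion,
    which will place the new index above the old one.\<close>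
  define k where "k = (GREATEST k. f_val \<epsilon> k \<le> v)"
  have k: "f_val \<epsilon> k \<le> v" unfolding k_def
    by (rule GreatestI_nat[of _ 0 b]) (use assms bound in auto)
  have kmax: "j \<le> k" if "f_val \<epsilon> j \<le> v" for j unfolding k_def
    by (rule Greatest_le_nat[of _ j b]) (use bound that in auto)
  have "\<not> f_val \<epsilon> (Suc k) \<le> v" using kmax[of "Suc k"] by auto
  then have 1: "real v + 1 \<le> (1 + \<epsilon>) * (1 + \<epsilon>) ^ k" using assms(1) by (simp add: f_val_le_iff)
  have "(1 + \<epsilon>) ^ k < real (f_val \<epsilon> k) + 1" using f_val_le_iff[OF assms(1), of k "f_val \<epsilon> k"] by simp
  then have "(1 + \<epsilon>) * (1 + \<epsilon>) ^ k < (1 + \<epsilon>) * (real (f_val \<epsilon> k) + 1)"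
    using assms(1) by (intro mult_strict_left_mono) auto
  \<comment> \<open>Maximality gives \<open>v + 1 \<le> (1 + \<epsilon>) ^ Suc k\<close>, and the
    floor loses less than 1.\<close>
  with 1 have 2: "real v < (1 + \<epsilon>) * real (f_val \<epsilon> k) + \<epsilon>" by (simp add: algebra_simps)
  have "(1 - \<epsilon>) * real v \<le> real (f_val \<epsilon> k)"
  proof (cases "\<epsilon> * real v < 1")
    case True
    have "f_val \<epsilon> k = v"
    proof (rule ccontr)
      assume "f_val \<epsilon> k \<noteq> v"
      then have "real (f_val \<epsilon> k) \<le> real v - 1" using k by linarith
      \<comment> \<open>A gap of at least one turns \<open>2\<close> into
        \<open>1 < \<epsilon> * v\<close>.\<close>
      then have "(1 + \<epsilon>) * real (f_val \<epsilon> k) \<le> (1 + \<epsilon>) * (real v - 1)"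
        using assms(1) by (intro mult_left_mono) auto
      with 2 True show False by (simp add: algebra_simps)
    qed
    then show ?thesis using assms by (simp add: algebra_simps)
  next
    case False
    then have "\<epsilon> * 1 \<le> \<epsilon> * (\<epsilon> * real v)" using assms(1) by (intro mult_left_mono) auto
    \<comment> \<open>The left side is \<open>v - \<epsilon> * (\<epsilon> * v)\<close>, and
      \<open>\<epsilon> * v \<ge> 1\<close> makes the loss at least \<open>\<epsilon>\<close>, the
      additive error in \<open>2\<close>.\<close>
    then have "(1 + \<epsilon>) * ((1 - \<epsilon>) * real v) \<le> real v - \<epsilon>" by (simp add: algebra_simps)
    then have "(1 + \<epsilon>) * ((1 - \<epsilon>) * real v) < (1 + \<epsilon>) * real (f_val \<epsilon> k)" using 2 by linarith
    then show ?thesis using assms(1) by simp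
  qed
  with k kmax show thesis using that by blast
qed

section \<open>Recurrence and range of the arrays D\<close>

lemma take_window: "take (Suc i * m) s = take (i * m) s @ substr s (i * m + 1) (Suc i * m)"
proof -
  have "substr s (i * m + 1) (Suc i * m) = take m (drop (i * m) s)" by (simp add: substr_def)
  then show ?thesis by (metis add.commute mult_Suc take_add)
qed

lemma new_array_le_first: "new_array \<epsilon> sbar s l r D k \<le> lcsp sbar s l r 1 (f_val \<epsilon> k)"
  by (simp add: new_array_def)

lemma new_array_le_extend:
  assumes "D k1 = enat c" "k1 \<le> k"
  shows "new_array \<epsilon> sbar s l r D k \<le> lcsp sbar s l r (Suc c) (f_val \<epsilon> k - f_val \<epsilon> k1)"
  unfolding new_array_def using assms by (intro min.coboundedI2 Inf_lower CollectI exI[of _ k1]) auto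

text \<open>Extended naturals are well ordered, so a finite infimum over the extensions is attained,
  and its index and start position can be named.\<close>

lemma new_array_cases:
  assumes "new_array \<epsilon> sbar s l r D k < \<infinity>"
  obtains "new_array \<epsilon> sbar s l r D k = lcsp sbar s l r 1 (f_val \<epsilon> k)"
  | k1 c where "k1 \<le> k" "D k1 = enat c"
      "new_array \<epsilon> sbar s l r D k = lcsp sbar s l r (Suc c) (f_val \<epsilon> k - f_val \<epsilon> k1)"
proof -
  let ?S = "{lcsp sbar s l r (the_enat (D k1) + 1) (f_val \<epsilon> k - f_val \<epsilon> k1) | k1. k1 \<le> k \<and> D k1 < \<infinity>}"
  have eq: "new_array \<epsilon> sbar s l r D k = min (lcsp sbar s l r 1 (f_val \<epsilon> k)) (Inf ?S)"
    by (simp add: new_array_def)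
  show thesis
  proof (cases "lcsp sbar s l r 1 (f_val \<epsilon> k) \<le> Inf ?S")
    case False
    then have eq: "new_array \<epsilon> sbar s l r D k = Inf ?S" using eq by (simp add: min_def)
    then have "Inf ?S \<noteq> \<infinity>" using assms by auto
    then have "?S \<noteq> {}" by (metis Inf_empty top_enat_def)
    then have "Inf ?S \<in> ?S" by (rule enat_Inf_mem)
    then obtain k1 where "k1 \<le> k" "D k1 < \<infinity>"
      "Inf ?S = lcsp sbar s l r (the_enat (D k1) + 1) (f_val \<epsilon> k - f_val \<epsilon> k1)" by blast
    then show thesis using that(2)[of k1 "the_enat (D k1)"] eq by (cases "D k1") auto
  qed (use eq that in \<open>simp add: min_def\<close>)
qed

text \<open>The third hypothesis excludes target 0 from start 0, the only case with value 0.\<close>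

lemma lcsp_range:
  assumes "lcsp sbar s l r (Suc c) k = enat q" "c \<le> length sbar" "0 < k \<or> 1 \<le> c"
  shows "1 \<le> q \<and> q \<le> length sbar"
  using lcsp_enatD[OF assms(1,2)] assms(3) by (cases q) (auto simp: substr_Suc)

text \<open>A fresh start has the positive target \<open>f_val \<epsilon> k\<close>; an extension
  starts behind a position at least 1 and so may have target 0, as happens for
  \<open>k1 = k\<close>.\<close>

lemma new_array_range:
  assumes "0 < \<epsilon>" "\<And>k c. D k = enat c \<Longrightarrow> 1 \<le> c \<and> c \<le> length sbar"
    "new_array \<epsilon> sbar s l r D k = enat q"
  shows "1 \<le> q \<and> q \<le> length sbar"
proof -
  have "new_array \<epsilon> sbar s l r D k < \<infinity>" using assms(3) by simp
  then show ?thesis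
  proof (cases rule: new_array_cases)
    case 1
    then show ?thesis using assms lcsp_range[of sbar s l r 0 "f_val \<epsilon> k" q] f_val_pos[of \<epsilon> k] by auto
  next
    case (2 k1 c)
    then show ?thesis using assms(3) assms(2)[OF 2(2)] lcsp_range[of sbar s l r c _ q] by auto
  qed
qed

lemma D_array_range:
  assumes "0 < \<epsilon>"
  shows "D_array \<epsilon> m sbar s i k = enat q \<Longrightarrow> 1 \<le> q \<and> q \<le> length sbar"
  by (induction i arbitrary: k q) (auto dest!: new_array_range[OF assms, rotated])

text \<open>A fresh start, or an extension of an entry \<open>k1 \<le> k'\<close>, only gets a
  smaller target. If \<open>k' < k1\<close>, the old entry \<open>k'\<close> is finite by induction,
  and extending it by target 0 keeps it.\<close>

lemma D_array_finite_downward: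
  assumes "0 < \<epsilon>"
  shows "D_array \<epsilon> m sbar s i k < \<infinity> \<Longrightarrow> k' \<le> k \<Longrightarrow> D_array \<epsilon> m sbar s i k' < \<infinity>"
proof (induction i arbitrary: k k')
  case (Suc i)
  let ?D = "D_array \<epsilon> m sbar s i" and ?l = "i * m + 1" and ?r = "Suc i * m"
  let ?T = "new_array \<epsilon> sbar s ?l ?r ?D"
  have f: "f_val \<epsilon> k' \<le> f_val \<epsilon> k" using f_val_mono[OF assms Suc.prems(2)] .
  have fin: "?T k < \<infinity>" using Suc.prems(1) by simp
  then have "?T k' < \<infinity>"
  proof (cases rule: new_array_cases)
    case 1
    have "?T k' \<le> lcsp sbar s ?l ?r 1 (f_val \<epsilon> k')" by (rule new_array_le_first)
    also have "\<dots> \<le> ?T k" using lcsp_antimono[OF f, of 0 sbar s ?l ?r] 1 by simp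
    finally show ?thesis using fin by (rule le_less_trans)
  next
    case (2 k1 c)
    have c: "c \<le> length sbar" using D_array_range[OF assms 2(2)] by simp
    show ?thesis
    proof (cases "k1 \<le> k'")
      case True
      have "?T k' \<le> lcsp sbar s ?l ?r (Suc c) (f_val \<epsilon> k' - f_val \<epsilon> k1)"
        by (rule new_array_le_extend[where D = ?D, OF 2(2) True])
      also have "\<dots> \<le> ?T k" unfolding 2(3) using f c by (intro lcsp_antimono) auto
      finally show ?thesis using fin by (rule le_less_trans)
    next
      case False
      then have "?D k' < \<infinity>" using Suc.IH[of k1 k'] 2(2) by simp
      then obtain c' where c': "?D k' = enat c'" by auto
      show ?thesis using new_array_le_extend[where D = ?D, OF c' order_refl, of \<epsilon> sbar s ?l ?r]
        by (auto simp: lcsp_def dest: enat_ile)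
    qed
  qed
  then show ?case by simp
qed simp

text \<open>Stated for arbitrary \<open>z\<close> and \<open>q\<close>, because the induction
  hypothesis is applied to the part of \<open>z\<close> in the earlier windows and to the end of its
  offline match. \<open>z\<close> is nonempty since \<open>f_val\<close> is at least 1; the upper
  bound by \<open>length z\<close> later controls indices beyond \<open>K\<close>.\<close>

lemma D_array_approx:
  assumes "0 < \<epsilon>" "\<epsilon> \<le> 1"
  shows "subseq z (take (i * m) s) \<Longrightarrow> subseq z (take q sbar) \<Longrightarrow> q \<le> length sbar \<Longrightarrow> z \<noteq> [] \<Longrightarrow>
    \<exists>k. D_array \<epsilon> m sbar s i k \<le> enat q \<and> f_val \<epsilon> k \<le> length z \<and>
        (1 - \<epsilon>) ^ i * real (length z) \<le> real (f_val \<epsilon> k)"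
proof (induction i arbitrary: z q)
  case (Suc i)
  let ?D = "D_array \<epsilon> m sbar s i" and ?l = "i * m + 1" and ?r = "Suc i * m"
  let ?T = "new_array \<epsilon> sbar s ?l ?r ?D"
  have pow: "0 \<le> (1 - \<epsilon>) ^ i" "(1 - \<epsilon>) ^ i \<le> 1" using assms by (auto intro: power_le_one)
  obtain z1 z2 where z: "z = z1 @ z2" "subseq z1 (take (i * m) s)" "subseq z2 (substr s ?l ?r)"
    using Suc.prems(1) unfolding take_window by (auto simp: subseq_append_iff)
  obtain x1 x2 where x: "take q sbar = x1 @ x2" "subseq z1 x1" "subseq z2 x2"
    using Suc.prems(2) unfolding z(1) by (auto dest: list_emb_appendD)
  define q1 where "q1 = length x1"
  have q1: "q1 \<le> q" using arg_cong[OF x(1), of length] Suc.prems(3) by (simp add: q1_def)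
  have x1: "x1 = take q1 sbar" using arg_cong[OF x(1), of "take q1"] q1 by (simp add: q1_def min_def)
  have x2: "x2 = drop q1 (take q sbar)" by (simp add: x(1) q1_def)
  show ?case
  proof (cases "z1 = []")
    case True
    then have len: "1 \<le> length z" "length z2 = length z" using z(1) Suc.prems(4) by (auto simp: Suc_le_eq)
    obtain k where k: "f_val \<epsilon> k \<le> length z" "(1 - \<epsilon>) * real (length z) \<le> real (f_val \<epsilon> k)"
      by (rule f_val_round_down[OF assms(1) len(1)])
    have "subseq z2 (substr sbar (Suc 0) q)" using Suc.prems(2) z(1) True by (simp add: substr_Suc)
    then have "f_val \<epsilon> k \<le> lcs (substr sbar (Suc 0) q) (substr s ?l ?r)"
      using length_le_lcs[OF _ z(3)] k(1) len(2) by fastforce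
    then have "lcsp sbar s ?l ?r (Suc 0) (f_val \<epsilon> k) \<le> enat q"
      using Suc.prems(3) by (intro lcsp_leI) auto
    then have "?T k \<le> enat q" using new_array_le_first[of \<epsilon> sbar s ?l ?r ?D k] by (simp add: order_trans)
    moreover have "(1 - \<epsilon>) ^ Suc i * real (length z) \<le> (1 - \<epsilon>) * real (length z)"
      using pow assms(2) by (intro mult_right_mono) (auto intro!: mult_left_le)
    ultimately show ?thesis using k by (intro exI[of _ k]) auto
  next
    case False
    obtain k1 where k1: "?D k1 \<le> enat q1" "f_val \<epsilon> k1 \<le> length z1"
        "(1 - \<epsilon>) ^ i * real (length z1) \<le> real (f_val \<epsilon> k1)"
      using Suc.IH[of z1 q1] z(2) x(2) q1 Suc.prems(3) False unfolding x1 by auto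
    obtain c where c: "?D k1 = enat c" "c \<le> q1" using k1(1) by (cases "?D k1") auto
    \<comment> \<open>\<open>v\<close> is the length guaranteed so far: the value recorded for
      \<open>z1\<close> plus all of \<open>z2\<close>. Rounding it down is the only loss in this
      window.\<close>
    define v where "v = f_val \<epsilon> k1 + length z2"
    have v1: "1 \<le> v" using f_val_pos[OF assms(1), of k1] by (simp add: v_def)
    obtain k where k: "f_val \<epsilon> k \<le> v" "(1 - \<epsilon>) * real v \<le> real (f_val \<epsilon> k)"
        "\<And>j. f_val \<epsilon> j \<le> v \<Longrightarrow> j \<le> k"
      using f_val_round_down[OF assms(1) v1] by metis
    have k1k: "k1 \<le> k" by (rule k(3)) (simp add: v_def)
    \<comment> \<open>The stored position \<open>c\<close> may lie before \<open>q1\<close>, which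
      only lengthens the offline piece available to \<open>z2\<close>.\<close>
    have "x2 = drop (q1 - c) (drop c (take q sbar))" using c(2) by (simp add: x2)
    then have "subseq x2 (drop c (take q sbar))" by (metis suffix_drop suffix_imp_subseq)
    then have "subseq z2 (substr sbar (Suc c) q)"
      unfolding substr_Suc using x(3) subseq_order.trans by blast
    then have "f_val \<epsilon> k - f_val \<epsilon> k1 \<le> lcs (substr sbar (Suc c) q) (substr s ?l ?r)"
      using length_le_lcs[OF _ z(3)] k(1) by (fastforce simp: v_def)
    then have "lcsp sbar s ?l ?r (Suc c) (f_val \<epsilon> k - f_val \<epsilon> k1) \<le> enat q"
      using Suc.prems(3) c q1 by (intro lcsp_leI) auto
    then have T: "?T k \<le> enat q"
      using new_array_le_extend[where D = ?D, OF c(1) k1k, of \<epsilon> sbar s ?l ?r] by (simp add: order_trans)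
    \<comment> \<open>The earlier factors are charged to \<open>z1\<close> only; \<open>z2\<close>
      counts in full.\<close>
    have "(1 - \<epsilon>) ^ i * real (length z2) \<le> real (length z2)" using pow by (intro mult_left_le_one_le) auto
    then have "(1 - \<epsilon>) ^ i * real (length z) \<le> real v" using k1(3) by (simp add: v_def z(1) algebra_simps)
    then have "(1 - \<epsilon>) * ((1 - \<epsilon>) ^ i * real (length z)) \<le> (1 - \<epsilon>) * real v"
      using assms(2) by (intro mult_left_mono) auto
    then have "(1 - \<epsilon>) ^ Suc i * real (length z) \<le> real (f_val \<epsilon> k)" using k(2) by (simp add: mult.assoc)
    moreover have "f_val \<epsilon> k \<le> length z" using k(1) k1(2) by (simp add: v_def z(1))
    ultimately show ?thesis using T by (intro exI[of _ k]) auto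
  qed
qed simp

section \<open>The index bound K and the output\<close>

lemma pow_le_iff_le_K_max:
  assumes "0 < \<epsilon>" "1 \<le> n"
  shows "(1 + \<epsilon>) ^ k \<le> real n \<longleftrightarrow> k \<le> K_max \<epsilon> n"
proof -
  have "(1 + \<epsilon>) ^ k \<le> real n \<longleftrightarrow> real k \<le> log (1 + \<epsilon>) (real n)"
    using assms by (simp add: le_log_iff powr_realpow)
  also have "\<dots> \<longleftrightarrow> k \<le> K_max \<epsilon> n" unfolding K_max_def using assms
    by (simp add: le_nat_iff le_floor_iff)
  finally show ?thesis .
qed

lemma alg_output_ge:
  assumes "D_array \<epsilon> m sbar s m k < \<infinity>" "k \<le> K_max \<epsilon> (length s)"
  shows "f_val \<epsilon> k \<le> alg_output \<epsilon> m sbar s"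
proof -
  let ?F = "{k. k \<le> K_max \<epsilon> (length s) \<and> D_array \<epsilon> m sbar s m k < \<infinity>}"
  have "k \<in> ?F" using assms by simp
  moreover have "finite ?F" by (rule finite_subset[of _ "{..K_max \<epsilon> (length s)}"]) auto
  ultimately show ?thesis unfolding alg_output_def Let_def by (auto intro!: Max_ge)
qed

text \<open>If the index found exceeds \<open>K\<close>, then
  \<open>n < (1 + \<epsilon>) ^ k < length z + 1\<close>, so \<open>z\<close> equals both strings.
  Entry \<open>K\<close> is then finite as well, and \<open>guard\<close> says that its value
  suffices.\<close>

lemma alg_output_approx:
  assumes "0 < \<epsilon>" "\<epsilon> \<le> 1" "1 \<le> n" "n = m ^ 2" "length sbar = n" "length s = n"
    and guard: "sbar \<noteq> s \<or> (1 - \<epsilon>) ^ m * real n \<le> real (f_val \<epsilon> (K_max \<epsilon> n))"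
  shows "(1 - \<epsilon>) ^ m * real (lcs sbar s) \<le> real (alg_output \<epsilon> m sbar s)"
proof -
  obtain z where z: "subseq z sbar" "subseq z s" "length z = lcs sbar s" by (rule lcs_witness)
  show ?thesis
  proof (cases "z = []")
    case True then show ?thesis using z(3) by simp
  next
    case False
    obtain k where k: "D_array \<epsilon> m sbar s m k \<le> enat n" "f_val \<epsilon> k \<le> length z"
       "(1 - \<epsilon>) ^ m * real (length z) \<le> real (f_val \<epsilon> k)"
      using D_array_approx[OF assms(1,2), of z m m s n sbar] z False assms(4-6)
      by (auto simp: power2_eq_square)
    have fin: "D_array \<epsilon> m sbar s m k < \<infinity>" using k(1) by (auto dest: enat_ile)
    show ?thesis
    proof (cases "k \<le> K_max \<epsilon> n")
      case True
      then show ?thesis using alg_output_ge[of \<epsilon> m sbar s k] fin k(3) z(3) assms(6) by fastforce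
    next
      case False
      then have "real n < (1 + \<epsilon>) ^ k" using pow_le_iff_le_K_max[of \<epsilon> n k] assms(1,3) by auto
      moreover have "(1 + \<epsilon>) ^ k < real (length z) + 1" using k(2) f_val_le_iff[OF assms(1)] by blast
      ultimately have "n \<le> length z" by linarith
      then have "z = sbar" "z = s" using z(1,2) assms(5,6)
        by (metis le_antisym list_emb_length subseq_same_length)+
      then have "(1 - \<epsilon>) ^ m * real n \<le> real (f_val \<epsilon> (K_max \<epsilon> n))" "lcs sbar s = n"
        using guard assms(5) z(3) by auto
      moreover have "f_val \<epsilon> (K_max \<epsilon> n) \<le> alg_output \<epsilon> m sbar s"
        using alg_output_ge[of \<epsilon> m sbar s "K_max \<epsilon> n"] D_array_finite_downward[OF assms(1) fin] False assms(6)
        by auto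
      ultimately show ?thesis by fastforce
    qed
  qed
qed

section \<open>Total correctness with bounded memory\<close>

lemma exec_final_mem: "exec sbar s c x t y \<Longrightarrow> y \<in> set (x # t)"
  by (induction rule: exec.induct) auto

text \<open>Effect of a successful \<open>put_cell\<close>, made total so that stores can be
  computed symbolically; the bounds become side conditions of the program rules.\<close>

definition write_at :: "'b list \<Rightarrow> nat \<Rightarrow> 'b \<Rightarrow> 'b list" where
  "write_at A i v = (if i < length A then A[i := v] else A @ [v])"

lemma put_cell_write_at:
  "a < length M \<Longrightarrow> i \<le> length (M ! a) \<Longrightarrow> put_cell M a i v = Some (M[a := write_at (M ! a) i v])"
  by (auto simp: put_cell_def write_at_def)

fun cell_le :: "'a cell \<Rightarrow> nat \<Rightarrow> bool" where
  "cell_le (Num u) v \<longleftrightarrow> u \<le> v"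
| "cell_le (Chr c) v \<longleftrightarrow> True"

text \<open>Caps on each array are preserved by any single write that respects them; the memory, a
  sum over all cells, is estimated from them only at the end.\<close>

definition bounded_store :: "(nat \<Rightarrow> nat) \<Rightarrow> (nat \<Rightarrow> nat) \<Rightarrow> 'a store \<Rightarrow> bool" where
  "bounded_store L V M \<longleftrightarrow> (\<forall>a<length M. length (M ! a) \<le> L a \<and> (\<forall>c\<in>set (M ! a). cell_le c (V a)))"

lemma bounded_store_write_at:
  assumes "bounded_store L V M" "i < L a" "cell_le v (V a)"
  shows "bounded_store L V (M[a := write_at (M ! a) i v])"
  unfolding bounded_store_def
proof (intro allI impI)
  fix b assume "b < length (M[a := write_at (M ! a) i v])"
  then have b: "b < length M" "length (M ! b) \<le> L b" "\<forall>c\<in>set (M ! b). cell_le c (V b)"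
    using assms(1) by (auto simp: bounded_store_def)
  show "length (M[a := write_at (M ! a) i v] ! b) \<le> L b \<and>
      (\<forall>c\<in>set (M[a := write_at (M ! a) i v] ! b). cell_le c (V b))"
    using b assms(2,3) by (cases "a = b") (auto simp: write_at_def dest: set_update_subset_insert[THEN subsetD])
qed

section \<open>A calculus for total correctness\<close>

locale machine =
  fixes sbar s :: "'a list" and L V :: "nat \<Rightarrow> nat"
begin

definition bounded :: "'a config \<Rightarrow> bool" where
  "bounded z \<longleftrightarrow> bounded_store L V (fst z)"

text \<open>A total-correctness triple that also bounds every entered configuration. Boundedness of
  \<open>x\<close> is a premise inside the definition, so the rules pass it on silently and
  invariants need not mention it.\<close>

definition runs :: "com \<Rightarrow> 'a config \<Rightarrow> ('a config \<Rightarrow> bool) \<Rightarrow> bool" where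
  "runs c x Q \<longleftrightarrow> (bounded x \<longrightarrow> (\<exists>t y. exec sbar s c x t y \<and> (\<forall>z\<in>set t. bounded z) \<and> Q y))"

lemma runs_Skip: "Q x \<Longrightarrow> runs Skip x Q"
  unfolding runs_def using exec.Skip by fastforce

lemma runs_Put:
  assumes "aval sbar M e = Some (Num i)" "aval sbar M e' = Some v"
    "a < length M" "i \<le> length (M ! a)" "i < L a" "cell_le v (V a)"
    "Q (M[a := write_at (M ! a) i v], pos)"
  shows "runs (Put a e e') (M, pos) Q"
  unfolding runs_def bounded_def
proof
  assume "bounded_store L V (fst (M, pos))"
  then have "bounded_store L V (M[a := write_at (M ! a) i v])"
    using bounded_store_write_at assms by simp
  then show "\<exists>t y. exec sbar s (Put a e e') (M, pos) t y \<and> (\<forall>z\<in>set t. bounded_store L V (fst z)) \<and> Q y"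
    using exec.Put[OF assms(1,2) put_cell_write_at[OF assms(3,4)], of s pos] assms(7) by fastforce
qed

lemma runs_Next:
  assumes "aval sbar M e = Some (Num i)" "pos < length s"
    "a < length M" "i \<le> length (M ! a)" "i < L a"
    "Q (M[a := write_at (M ! a) i (Chr (s ! pos))], Suc pos)"
  shows "runs (Next a e) (M, pos) Q"
  unfolding runs_def bounded_def
proof
  assume "bounded_store L V (fst (M, pos))"
  then have "bounded_store L V (M[a := write_at (M ! a) i (Chr (s ! pos))])"
    using bounded_store_write_at[of L V M i a "Chr (s ! pos)"] assms by simp
  then show "\<exists>t y. exec sbar s (Next a e) (M, pos) t y \<and> (\<forall>z\<in>set t. bounded_store L V (fst z)) \<and> Q y"
    using exec.Next[OF assms(1,2) put_cell_write_at[OF assms(3,4)]] assms(6) by fastforce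
qed

lemma runs_Seq: "runs c x (\<lambda>y. runs c' y Q) \<Longrightarrow> runs (Seq c c') x Q"
  unfolding runs_def
proof
  assume *: "bounded x \<longrightarrow> (\<exists>t y. exec sbar s c x t y \<and> (\<forall>z\<in>set t. bounded z) \<and>
    (bounded y \<longrightarrow> (\<exists>t z. exec sbar s c' y t z \<and> (\<forall>z\<in>set t. bounded z) \<and> Q z)))" "bounded x"
  then obtain t y where t: "exec sbar s c x t y" "\<forall>z\<in>set t. bounded z"
    "bounded y \<longrightarrow> (\<exists>t z. exec sbar s c' y t z \<and> (\<forall>z\<in>set t. bounded z) \<and> Q z)" by blast
  then have "bounded y" using exec_final_mem[OF t(1)] *(2) by auto
  then obtain t' z where "exec sbar s c' y t' z" "\<forall>z\<in>set t'. bounded z" "Q z" using t(3) by blast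
  then show "\<exists>t z. exec sbar s (Seq c c') x t z \<and> (\<forall>z\<in>set t. bounded z) \<and> Q z"
    using exec.Seq[OF t(1)] t(2) by (metis UnE set_append)
qed

lemma runs_Cond:
  assumes "bval sbar (fst x) b = Some v" "v \<Longrightarrow> runs c x Q" "\<not> v \<Longrightarrow> runs c' x Q"
  shows "runs (Cond b c c') x Q"
proof (cases v)
  case True
  with assms(1) have "bval sbar (fst x) b = Some True" by simp
  with assms(2)[OF True] show ?thesis using exec.CondTrue unfolding runs_def by blast
next
  case False
  with assms(1) have "bval sbar (fst x) b = Some False" by simp
  with assms(3)[OF False] show ?thesis using exec.CondFalse unfolding runs_def by blast
qed

text \<open>The loop makes exactly \<open>N\<close> rounds, with \<open>Inv i\<close> true after
  \<open>i\<close> of them, so \<open>N - i\<close> decreases. The last conjunct keeps the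
  configurations between rounds: the array must be exhibited after every window, not just at the
  end.\<close>

lemma exec_While:
  assumes "\<And>i y. i < N \<Longrightarrow> Inv i y \<Longrightarrow> bval sbar (fst y) b = Some True \<and> runs c y (Inv (Suc i))"
    "\<And>y. Inv N y \<Longrightarrow> bval sbar (fst y) b = Some False"
    "bounded x"
  shows "i \<le> N \<Longrightarrow> Inv i x \<Longrightarrow> \<exists>t y. exec sbar s (While b c) x t y \<and> (\<forall>z\<in>set t. bounded z) \<and> Inv N y \<and>
    (\<forall>j. i \<le> j \<and> j \<le> N \<longrightarrow> (\<exists>z\<in>set (x # t). Inv j z))"
  using assms(3)
proof (induction "N - i" arbitrary: i x)
  case 0
  then have "i = N" by simp
  then show ?case using 0 assms(2)[of x] exec.WhileFalse[of sbar x b s c]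
    by (intro exI[of _ "[]"] exI[of _ x]) auto
next
  case (Suc k)
  then have iN: "i < N" by simp
  obtain t y where t: "exec sbar s c x t y" "\<forall>z\<in>set t. bounded z" "Inv (Suc i) y"
    using assms(1)[OF iN Suc.prems(2)] Suc.prems(3) unfolding runs_def by blast
  have y: "y \<in> set (x # t)" "bounded y" using exec_final_mem[OF t(1)] t(2) Suc.prems(3) by auto
  obtain t' z where t': "exec sbar s (While b c) y t' z" "\<forall>z\<in>set t'. bounded z" "Inv N z"
    "\<forall>j. Suc i \<le> j \<and> j \<le> N \<longrightarrow> (\<exists>z\<in>set (y # t'). Inv j z)"
    using Suc.hyps(1)[of "Suc i" y] Suc.hyps(2) iN t(3) y(2)
    by (metis Suc_diff_Suc Suc_inject Suc_leI)
  have vis: "\<exists>z\<in>set (x # t @ t'). Inv j z" if "i \<le> j" "j \<le> N" for j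
  proof (cases "j = i")
    case False
    then have "Suc i \<le> j" using that(1) by simp
    then obtain z where "z \<in> set (y # t')" "Inv j z" using t'(4) \<open>j \<le> N\<close> by blast
    then show ?thesis using y(1) by auto
  qed (use Suc.prems in auto)
  have "exec sbar s (While b c) x (t @ t') z"
    using exec.WhileTrue[OF _ t(1) t'(1)] assms(1)[OF iN Suc.prems(2)] by blast
  then show ?case using vis t(2) t'(2,3) by (intro exI[of _ "t @ t'"] exI[of _ z]) auto
qed

lemma runs_While:
  assumes "Inv 0 x"
    "\<And>i y. i < N \<Longrightarrow> Inv i y \<Longrightarrow> bval sbar (fst y) b = Some True \<and> runs c y (Inv (Suc i))"
    "\<And>y. Inv N y \<Longrightarrow> bval sbar (fst y) b = Some False \<and> Q y"
  shows "runs (While b c) x Q"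
  unfolding runs_def using exec_While[of N Inv b c x 0] assms by blast

text \<open>The premise is one case expression, which the simplifier evaluates; no witnesses for
  \<open>i\<close> and \<open>v\<close> need to be supplied.\<close>

lemma runs_PutI:
  assumes "case (aval sbar M e, aval sbar M e') of
      (Some (Num i), Some v) \<Rightarrow> a < length M \<and> i \<le> length (M ! a) \<and> i < L a \<and> cell_le v (V a) \<and>
        Q (M[a := write_at (M ! a) i v], pos)
    | _ \<Rightarrow> False"
  shows "runs (Put a e e') (M, pos) Q"
  using assms by (auto split: option.splits cell.splits intro!: runs_Put)

lemma runs_NextI:
  assumes "case aval sbar M e of
      Some (Num i) \<Rightarrow> pos < length s \<and> a < length M \<and> i \<le> length (M ! a) \<and> i < L a \<and>
        Q (M[a := write_at (M ! a) i (Chr (s ! pos))], Suc pos)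
    | _ \<Rightarrow> False"
  shows "runs (Next a e) (M, pos) Q"
  using assms by (auto split: option.splits cell.splits intro!: runs_Next)

lemma runs_CondI:
  assumes "case bval sbar M b of Some v \<Rightarrow> if v then runs c (M, pos) Q else runs c' (M, pos) Q | None \<Rightarrow> False"
  shows "runs (Cond b c c') (M, pos) Q"
  using assms by (auto split: option.splits if_splits intro!: runs_Cond)

end

section \<open>A program for the algorithm\<close>

lemma write_at_single [simp]: "write_at [] 0 v = [v]" "write_at [u] 0 v = [v]"
  by (auto simp: write_at_def)

lemma length_write_at: "i \<le> length A \<Longrightarrow> length (write_at A i v) = max (length A) (Suc i)"
  by (auto simp: write_at_def)

lemma take_write_at: "i \<le> length A \<Longrightarrow> take (Suc i) (write_at A i v) = take i A @ [v]"
  by (auto simp: write_at_def take_Suc_conv_app_nth)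

lemma write_at_map_upt:
  "i < N \<Longrightarrow> write_at (map h [0..<N]) i v = map (\<lambda>x. if x = i then v else h x) [0..<N]"
  by (auto simp: write_at_def nth_list_update intro!: nth_equalityI)

section \<open>Rows of the dynamic program\<close>

definition lcs_row :: "'a list \<Rightarrow> 'a list \<Rightarrow> 'a cell list" where
  "lcs_row w X = map (\<lambda>x. Num (lcs X (take x w))) [0..<Suc (length w)]"

text \<open>The row is overwritten in place from left to right: entries up to \<open>j\<close>
  belong to \<open>X\<close> extended by \<open>a\<close>, the later ones still to
  \<open>X\<close>.\<close>

definition lcs_row_upto :: "'a list \<Rightarrow> 'a list \<Rightarrow> 'a \<Rightarrow> nat \<Rightarrow> 'a cell list" where
  "lcs_row_upto w X a j = map (\<lambda>x. Num (lcs (if x \<le> j then X @ [a] else X) (take x w))) [0..<Suc (length w)]"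

lemma lcs_row_Nil: "lcs_row w [] = replicate (Suc (length w)) (Num 0)"
  by (auto simp: lcs_row_def map_replicate_const simp del: upt_Suc replicate_Suc)

lemma length_lcs_row [simp]: "length (lcs_row w X) = Suc (length w)"
  "length (lcs_row_upto w X a j) = Suc (length w)"
  by (auto simp: lcs_row_def lcs_row_upto_def)

lemma nth_lcs_row: "m = length w \<Longrightarrow> lcs_row w X ! m = Num (lcs X w)"
  by (simp add: lcs_row_def del: upt_Suc)

lemma lcs_row_upto_nth [simp]:
  "j \<le> length w \<Longrightarrow> lcs_row_upto w X a j ! j = Num (lcs (X @ [a]) (take j w))"
  "j < length w \<Longrightarrow> lcs_row_upto w X a j ! Suc j = Num (lcs X (take (Suc j) w))"
  by (auto simp: lcs_row_upto_def simp del: upt_Suc)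

text \<open>Entry 0 compares with the empty prefix and is 0 in both rows, so overwriting can begin
  at entry 1.\<close>

lemma lcs_row_upto_0: "lcs_row w X = lcs_row_upto w X a 0"
  by (auto simp: lcs_row_def lcs_row_upto_def)

lemma lcs_row_upto_length: "lcs_row_upto w X a (length w) = lcs_row w (X @ [a])"
  by (auto simp: lcs_row_def lcs_row_upto_def)

lemma lcs_row_upto_Suc:
  assumes "lcs (X @ [a]) (take (Suc j) w) = v" "j < length w"
  shows "write_at (lcs_row_upto w X a j) (Suc j) (Num v) = lcs_row_upto w X a (Suc j)"
  using assms by (auto simp: lcs_row_upto_def write_at_map_upt simp del: upt_Suc)

text \<open>For the branch that leaves a cell untouched: the old value is already right.\<close>

lemma lcs_row_upto_Suc_same:
  assumes "lcs (X @ [a]) (take (Suc j) w) = lcs X (take (Suc j) w)"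
  shows "lcs_row_upto w X a (Suc j) = lcs_row_upto w X a j"
  using assms by (auto simp: lcs_row_upto_def le_Suc_eq simp del: upt_Suc)

lemma lcs_take_Suc:
  assumes "j < length w"
  shows "lcs (X @ [a]) (take (Suc j) w) = (if w ! j = a then Suc (lcs X (take j w))
    else max (lcs (X @ [a]) (take j w)) (lcs X (take (Suc j) w)))"
  using assms by (simp add: take_Suc_conv_app_nth lcs_snoc)

section \<open>The program text\<close>

abbreviation var :: "nat \<Rightarrow> aexp" where "var a \<equiv> Cell a (Const 0)"
abbreviation set_var :: "nat \<Rightarrow> aexp \<Rightarrow> com" where "set_var a e \<equiv> Put a (Const 0) e"
abbreviation incr :: "nat \<Rightarrow> com" where "incr a \<equiv> set_var a (Plus (var a) (Const (Suc 0)))"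

text \<open>A list form of \<open>Seq\<close>. Its equations are kept out of the simplifier, so that
  \<open>runs_block\<close> peels off one command at a time.\<close>

fun block :: "com list \<Rightarrow> com" where
  "block [] = Skip"
| "block [c] = c"
| "block (c # c' # cs) = Seq c (block (c' # cs))"

declare block.simps [simp del]

lemma (in machine) runs_block: "runs c x (\<lambda>y. runs (block (c' # cs)) y Q) \<Longrightarrow> runs (block (c # c' # cs)) x Q"
  by (simp add: block.simps runs_Seq)

lemma (in machine) runs_block_single: "runs c x Q \<Longrightarrow> runs (block [c]) x Q"
  by (simp add: block.simps)

text \<open>
  Array 6 holds the window, array 7 the row of the dynamic program. The remaining arrays have a
  single cell: 8 counts windows, 9 is \<open>k\<close>, 10 is the candidate (0 for a fresh start, \<open>k1 + 1\<close> for
  the extension of \<open>D k1\<close>), 11 is the best candidate, 12 and 13 are \<open>p - 1\<close> and the target for the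
  computation of \<open>lcsp\<close>, 14 is \<open>q\<close>, 15 indexes arrays, 16 and 17 keep the entries of the old row
  that are overwritten but still needed. The literal 1 is spelled \<open>Suc 0\<close>, its simplifier normal
  form, so that the rules for loops still match after simplification.
\<close>

definition cell_step :: com where
  "cell_step = block [
     set_var 17 (Cell 7 (Plus (var 15) (Const (Suc 0)))),
     Cond (Eq (Cell 6 (var 15)) (Offline (var 14)))
       (Put 7 (Plus (var 15) (Const (Suc 0))) (Plus (var 16) (Const (Suc 0))))
       (Cond (Less (Cell 7 (Plus (var 15) (Const (Suc 0)))) (Cell 7 (var 15)))
         (Put 7 (Plus (var 15) (Const (Suc 0))) (Cell 7 (var 15)))
         Skip),
     set_var 16 (var 17),
     incr 15]"

definition row_step :: com where
  "row_step = block [incr 14, set_var 15 (Const 0), set_var 16 (Const 0),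
     While (Less (var 15) (var (Suc 0))) cell_step]"

text \<open>Zeros form the row of the empty offline piece. \<open>q\<close> starts at
  \<open>p - 1\<close>, so target 0 ends the loop at once with the value that \<open>lcsp\<close>
  prescribes; otherwise it ends when the last entry of the row reaches the target or the string is
  used up.\<close>

definition lcsp_prog :: com where
  "lcsp_prog = block [
     set_var 15 (Const 0),
     While (Less (var 15) (Plus (var (Suc 0)) (Const (Suc 0)))) (block [Put 7 (var 15) (Const 0), incr 15]),
     set_var 14 (var 12),
     While (Conj (Less (Cell 7 (var (Suc 0))) (var 13)) (Less (var 14) (var 0))) row_step]"

definition try_prog :: com where
  "try_prog = block [lcsp_prog,
     Cond (Less (Cell 7 (var (Suc 0))) (var 13))
       Skip
       (Cond (Conj (Neg (Eq (var 11) (Const 0))) (Neg (Less (var 14) (var 11)))) Skip (set_var 11 (var 14)))]"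

text \<open>For an extension, array 12 receives entry \<open>k1\<close> of D, which is
  \<open>p - 1\<close> for the new start \<open>p\<close>; 0 there means an infinite entry and skips
  the search.\<close>

definition candidate_prog :: com where
  "candidate_prog = block [
     Cond (Eq (var 10) (Const 0))
       (block [set_var 12 (Const 0), set_var 13 (Cell 3 (var 9))])
       (block [set_var 12 (Cell 4 (Minus (var 10) (Const (Suc 0)))),
         set_var 13 (Minus (Cell 3 (var 9)) (Cell 3 (Minus (var 10) (Const (Suc 0)))))]),
     Cond (Conj (Neg (Eq (var 10) (Const 0))) (Eq (var 12) (Const 0)))
       Skip
       try_prog,
     incr 10]"

text \<open>Array 9 holds \<open>k + 1\<close> on entry and is decreased first, so the indices run
  from \<open>K\<close> down to 0 without negative numbers. The candidates are the fresh start and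
  \<open>k + 1\<close> extensions, hence the bound \<open>k + 2\<close>.\<close>

definition entry_prog :: com where
  "entry_prog = block [
     set_var 9 (Minus (var 9) (Const (Suc 0))), set_var 11 (Const 0), set_var 10 (Const 0),
     While (Less (var 10) (Plus (var 9) (Const 2))) candidate_prog,
     Put 4 (var 9) (var 11)]"

definition window_prog :: com where
  "window_prog = block [
     set_var 15 (Const 0),
     While (Less (var 15) (var (Suc 0))) (block [Next 6 (var 15), incr 15]),
     set_var 9 (Plus (var 2) (Const (Suc 0))),
     While (Less (Const 0) (var 9)) entry_prog,
     incr 8]"

definition init_prog :: com where
  "init_prog = block [
     set_var 5 (Const 0), set_var 8 (Const 0), set_var 9 (Const 0), set_var 10 (Const 0),
     set_var 11 (Const 0), set_var 12 (Const 0), set_var 13 (Const 0), set_var 14 (Const 0),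
     set_var 16 (Const 0), set_var 17 (Const 0), set_var 15 (Const 0),
     While (Less (var 15) (Plus (var 2) (Const (Suc 0)))) (block [Put 4 (var 15) (Const 0), incr 15])]"

text \<open>\<open>f_val\<close> is monotone, so overwriting the output at each finite entry leaves
  the largest value.\<close>

definition output_prog :: com where
  "output_prog = block [
     set_var 9 (Const 0),
     While (Less (var 9) (Plus (var 2) (Const (Suc 0))))
       (block [Cond (Less (Const 0) (Cell 4 (var 9))) (set_var 5 (Cell 3 (var 9))) Skip, incr 9])]"

definition main_prog :: com where
  "main_prog = Seq init_prog (Seq (While (Less (var 8) (var (Suc 0))) window_prog) output_prog)"

section \<open>Candidates for an entry and their encoding\<close>

lemma lcsp_eq_enatI:
  assumes "p \<le> q" "q \<le> length sbar" "g \<le> lcs (substr sbar (Suc p) q) (substr s l r)"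
    "\<And>q'. p \<le> q' \<Longrightarrow> q' < q \<Longrightarrow> lcs (substr sbar (Suc p) q') (substr s l r) < g"
  shows "lcsp sbar s l r (Suc p) g = enat q"
proof -
  have le: "lcsp sbar s l r (Suc p) g \<le> enat q" using assms by (intro lcsp_leI)
  then obtain q0 where q0: "lcsp sbar s l r (Suc p) g = enat q0" "q0 \<le> q"
    by (cases "lcsp sbar s l r (Suc p) g") auto
  have "\<not> q0 < q" using lcsp_enatD[OF q0(1)] assms(1,2) assms(4)[of q0] by fastforce
  with q0 show ?thesis by simp
qed

lemma lcsp_eq_infinityI:
  assumes "p \<le> length sbar" "\<And>q. p \<le> q \<Longrightarrow> q \<le> length sbar \<Longrightarrow> lcs (substr sbar (Suc p) q) (substr s l r) < g"
  shows "lcsp sbar s l r (Suc p) g = \<infinity>"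
proof (cases "lcsp sbar s l r (Suc p) g")
  case (enat q)
  show ?thesis using lcsp_enatD[OF enat assms(1)] assms(2)[of q] by simp
qed

text \<open>Numbered as in array 10: 0 is the fresh start, \<open>Suc k1\<close> the extension of
  entry \<open>k1\<close>. An infinite entry yields \<open>\<infinity>\<close>, the neutral element
  of the minimum.\<close>

definition candidate :: "real \<Rightarrow> 'a list \<Rightarrow> 'a list \<Rightarrow> nat \<Rightarrow> nat \<Rightarrow> (nat \<Rightarrow> enat) \<Rightarrow> nat \<Rightarrow> nat \<Rightarrow> enat" where
  "candidate \<epsilon> sbar s l r D k c = (case c of
     0 \<Rightarrow> lcsp sbar s l r 1 (f_val \<epsilon> k)
   | Suc k1 \<Rightarrow> (case D k1 of
       enat p \<Rightarrow> lcsp sbar s l r (Suc p) (f_val \<epsilon> k - f_val \<epsilon> k1)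
     | \<infinity> \<Rightarrow> \<infinity>))"

text \<open>Brings the minimum into the form in which a loop over candidates accumulates it.\<close>

lemma new_array_eq_Inf_candidate:
  "new_array \<epsilon> sbar s l r D k = Inf (candidate \<epsilon> sbar s l r D k ` {..<k + 2})"
proof (rule antisym)
  show "new_array \<epsilon> sbar s l r D k \<le> Inf (candidate \<epsilon> sbar s l r D k ` {..<k + 2})"
  proof (rule INF_greatest)
    fix c assume "c \<in> {..<k + 2}"
    then show "new_array \<epsilon> sbar s l r D k \<le> candidate \<epsilon> sbar s l r D k c"
      using new_array_le_first[of \<epsilon> sbar s l r D k] new_array_le_extend[of D _ _ k \<epsilon> sbar s l r]
      by (auto simp: candidate_def split: nat.splits enat.splits)
  qed
next
  show "Inf (candidate \<epsilon> sbar s l r D k ` {..<k + 2}) \<le> new_array \<epsilon> sbar s l r D k"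
  proof (cases "new_array \<epsilon> sbar s l r D k < \<infinity>")
    case True
    then show ?thesis
    proof (cases rule: new_array_cases)
      case 1
      show ?thesis unfolding 1 by (rule INF_lower2[of 0]) (auto simp: candidate_def)
    next
      case (2 k1 c)
      show ?thesis unfolding 2(3) by (rule INF_lower2[of "Suc k1"]) (use 2(1,2) in \<open>auto simp: candidate_def\<close>)
    qed
  qed simp
qed

definition encode :: "enat \<Rightarrow> nat" where
  "encode x = (case x of enat q \<Rightarrow> q | \<infinity> \<Rightarrow> 0)"

lemma encode_simps [simp]: "encode (enat q) = q" "encode \<infinity> = 0"
  by (auto simp: encode_def)

lemma entry_cell_encode: "entry_cell x = Num (encode x)"
  by (cases x) auto

text \<open>The right side is the test by which the program updates its best value.
  \<open>A \<noteq> enat 0\<close> makes 0 an unambiguous code for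
  \<open>\<infinity>\<close>.\<close>

lemma encode_min_enat:
  "A \<noteq> enat 0 \<Longrightarrow> encode (min A (enat q)) = (if encode A \<noteq> 0 \<and> \<not> q < encode A then encode A else q)"
  by (cases A) (auto simp: min_def)

section \<open>Verification of the program\<close>

locale lcs_run =
  fixes \<epsilon> :: real and n m :: nat and sbar s :: "'a list"
  assumes eps: "0 < \<epsilon>" and n: "2 \<le> n" "n = m ^ 2" and len: "length sbar = n" "length s = n"
begin

abbreviation "K \<equiv> K_max \<epsilon> n"
abbreviation "f \<equiv> f_val \<epsilon>"

text \<open>Arrays 3 and 4 need \<open>K + 1\<close> cells, array 6 needs \<open>m\<close>, array 7
  needs \<open>m + 1\<close>; one common cap covers them.\<close>

definition len_cap :: "nat \<Rightarrow> nat" where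
  "len_cap a = (if a \<in> {3, 4, 6, 7} then m + K + 3 else 1)"

text \<open>\<open>K\<close> can be far larger than \<open>n\<close> when \<open>\<epsilon>\<close>
  is small. The long arrays hold only characters and numbers up to \<open>n\<close>, so
  \<open>K\<close> enlarges just the values in single-cell arrays.\<close>

definition val_cap :: "nat \<Rightarrow> nat" where
  "val_cap a = (if a \<in> {3, 4, 6, 7} then n else n + K + 3)"

sublocale machine sbar s len_cap val_cap .

text \<open>Arrays 0 to 3 are never written and stay fixed; every other array is an argument, so
  that execution becomes rewriting of arguments.\<close>

definition st where
  "st D out win row i k c b p g q j d e =
    ([[Num n], [Num m], [Num K], map (\<lambda>k. Num (f k)) [0..<Suc K],
     D, out, win, row, i, k, c, b, p, g, q, j, d, e] :: 'a store)"

lemma st_length [simp]: "length (st D out win row i k c b p g q j d e) = 18"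
  by (simp add: st_def)

lemma st_nth [simp]:
  "st D out win row i k c b p g q j d e ! 0 = [Num n]"
  "st D out win row i k c b p g q j d e ! (Suc 0) = [Num m]"
  "st D out win row i k c b p g q j d e ! 2 = [Num K]"
  "st D out win row i k c b p g q j d e ! 3 = map (\<lambda>k. Num (f k)) [0..<Suc K]"
  "st D out win row i k c b p g q j d e ! 4 = D"
  "st D out win row i k c b p g q j d e ! 5 = out"
  "st D out win row i k c b p g q j d e ! 6 = win"
  "st D out win row i k c b p g q j d e ! 7 = row"
  "st D out win row i k c b p g q j d e ! 8 = i"
  "st D out win row i k c b p g q j d e ! 9 = k"
  "st D out win row i k c b p g q j d e ! 10 = c"
  "st D out win row i k c b p g q j d e ! 11 = b"
  "st D out win row i k c b p g q j d e ! 12 = p"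
  "st D out win row i k c b p g q j d e ! 13 = g"
  "st D out win row i k c b p g q j d e ! 14 = q"
  "st D out win row i k c b p g q j d e ! 15 = j"
  "st D out win row i k c b p g q j d e ! 16 = d"
  "st D out win row i k c b p g q j d e ! 17 = e"
  by (simp_all add: st_def)

lemma st_update [simp]:
  "(st D out win row i k c b p g q j d e)[4 := x] = st x out win row i k c b p g q j d e"
  "(st D out win row i k c b p g q j d e)[5 := x] = st D x win row i k c b p g q j d e"
  "(st D out win row i k c b p g q j d e)[6 := x] = st D out x row i k c b p g q j d e"
  "(st D out win row i k c b p g q j d e)[7 := x] = st D out win x i k c b p g q j d e"
  "(st D out win row i k c b p g q j d e)[8 := x] = st D out win row x k c b p g q j d e"
  "(st D out win row i k c b p g q j d e)[9 := x] = st D out win row i x c b p g q j d e"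
  "(st D out win row i k c b p g q j d e)[10 := x] = st D out win row i k x b p g q j d e"
  "(st D out win row i k c b p g q j d e)[11 := x] = st D out win row i k c x p g q j d e"
  "(st D out win row i k c b p g q j d e)[12 := x] = st D out win row i k c b x g q j d e"
  "(st D out win row i k c b p g q j d e)[13 := x] = st D out win row i k c b p x q j d e"
  "(st D out win row i k c b p g q j d e)[14 := x] = st D out win row i k c b p g x j d e"
  "(st D out win row i k c b p g q j d e)[15 := x] = st D out win row i k c b p g q x d e"
  "(st D out win row i k c b p g q j d e)[16 := x] = st D out win row i k c b p g q j x e"
  "(st D out win row i k c b p g q j d e)[17 := x] = st D out win row i k c b p g q j d x"
  by (simp_all add: st_def eval_nat_numeral)

lemma st_inject [simp]:
  "st D out win row i k c b p g q j d e = st D' out' win' row' i' k' c' b' p' g' q' j' d' e' \<longleftrightarrow>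
    D = D' \<and> out = out' \<and> win = win' \<and> row = row' \<and> i = i' \<and> k = k' \<and> c = c' \<and> b = b' \<and>
    p = p' \<and> g = g' \<and> q = q' \<and> j = j' \<and> d = d' \<and> e = e'"
  by (auto simp: st_def)

lemma m_bounds: "1 \<le> m" "m \<le> n"
proof -
  show "1 \<le> m" using n by (cases m) auto
  then show "m \<le> n" using n(2) by (simp add: power2_eq_square)
qed

lemmas runs_intros = runs_block runs_block_single runs_PutI runs_CondI runs_NextI runs_Skip

text \<open>The diagonal entry of the table may already be overwritten and survives in array 16;
  array 17 saves the old entry \<open>Suc j\<close> for the next round. On a mismatch that entry is
  overwritten only if its left neighbour is larger, which yields the maximum.\<close>

lemma runs_cell_step:
  assumes "length w = m" "j < m" "q < n"
    "\<And>e. Q (st D out (map Chr w) (lcs_row_upto w X (sbar ! q) (Suc j)) i k c b p g [Num (Suc q)] [Num (Suc j)]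
        [Num (lcs X (take (Suc j) w))] [e], pos)"
  shows "runs cell_step (st D out (map Chr w) (lcs_row_upto w X (sbar ! q) j) i k c b p g [Num (Suc q)] [Num j]
        [Num (lcs X (take j w))] [e0], pos) Q"
proof -
  have le: "lcs Y (take x w) \<le> n" "lcs Y (take x w) \<le> n + K + 3" "Suc (lcs Y (take j w)) \<le> n" for Y x
    using lcs_le_length(2)[of Y "take x w"] lcs_le_length(2)[of Y "take j w"] assms(1,2) m_bounds by auto
  show ?thesis unfolding cell_step_def
    using assms(2-4) le m_bounds(2) lcs_take_Suc[of j w X "sbar ! q"]
    by (auto intro!: runs_intros simp: assms(1) len len_cap_def val_cap_def lcs_row_upto_Suc lcs_row_upto_Suc_same)
qed

lemma runs_row_step:
  assumes "length w = m" "q < n"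
    "\<And>j d e. Q (st D out (map Chr w) (lcs_row w (X @ [sbar ! q])) i k c b p g [Num (Suc q)] [j] [d] [e], pos)"
  shows "runs row_step (st D out (map Chr w) (lcs_row w X) i k c b p g [Num q] [j] [d] [e], pos) Q"
proof -
  have loop: "runs (While (Less (var 15) (var (Suc 0))) cell_step)
      (st D out (map Chr w) (lcs_row w X) i k c b p g [Num (Suc q)] [Num 0] [Num 0] [e], pos) Q"
    by (rule runs_While[where N = m and Inv = "\<lambda>j y. \<exists>e. y = (st D out (map Chr w)
          (lcs_row_upto w X (sbar ! q) j) i k c b p g [Num (Suc q)] [Num j] [Num (lcs X (take j w))] [e], pos)"])
      (use assms(2,3) lcs_row_upto_length[of w X "sbar ! q"] in
        \<open>auto intro!: runs_cell_step simp: assms(1) lcs_row_upto_0[symmetric]\<close>)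
  show ?thesis unfolding row_step_def
    using assms(2) by (auto intro!: runs_intros loop simp: len_cap_def val_cap_def)
qed

text \<open>The array can be empty or hold an old row, so a write either appends or overwrites; the
  invariant therefore fixes only the first \<open>j\<close> cells.\<close>

lemma runs_reset_row:
  assumes "length w = m" "length row \<le> Suc m"
    "Q (st D out win (lcs_row w []) i k c b p g q [Num (Suc m)] d [e], pos)"
  shows "runs (While (Less (var 15) (Plus (var (Suc 0)) (Const (Suc 0)))) (block [Put 7 (var 15) (Const 0), incr 15]))
    (st D out win row i k c b p g q [Num 0] d [e], pos) Q"
proof (rule runs_While[where N = "Suc m" and Inv = "\<lambda>j y. \<exists>R. j \<le> length R \<and> length R \<le> Suc m \<and>
      take j R = replicate j (Num 0) \<and> y = (st D out win R i k c b p g q [Num j] d [e], pos)"])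
  fix j y
  assume "j < Suc m" "\<exists>R. j \<le> length R \<and> length R \<le> Suc m \<and>
      take j R = replicate j (Num 0) \<and> y = (st D out win R i k c b p g q [Num j] d [e], pos)"
  then show "bval sbar (fst y) (Less (var 15) (Plus (var (Suc 0)) (Const (Suc 0)))) = Some True \<and>
    runs (block [Put 7 (var 15) (Const 0), incr 15]) y (\<lambda>y. \<exists>R. Suc j \<le> length R \<and> length R \<le> Suc m \<and>
      take (Suc j) R = replicate (Suc j) (Num 0) \<and> y = (st D out win R i k c b p g q [Num (Suc j)] d [e], pos))"
    using m_bounds by (auto intro!: runs_intros simp: len_cap_def val_cap_def length_write_at take_write_at
        replicate_append_same)
qed (use assms(2,3) in \<open>auto simp: lcs_row_Nil assms(1) simp del: replicate_Suc\<close>)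

lemma runs_lcsp_prog:
  assumes "length w = m" "length row \<le> Suc m" "p \<le> n"
    "\<And>q j d e. p \<le> q \<Longrightarrow> q \<le> n \<Longrightarrow> g \<le> lcs (substr sbar (Suc p) q) w \<or> q = n \<Longrightarrow>
      (\<And>q'. p \<le> q' \<Longrightarrow> q' < q \<Longrightarrow> lcs (substr sbar (Suc p) q') w < g) \<Longrightarrow>
      Q (st D out (map Chr w) (lcs_row w (substr sbar (Suc p) q)) i k c b [Num p] [Num g] [Num q] [j] [d] [e], pos)"
  shows "runs lcsp_prog (st D out (map Chr w) row i k c b [Num p] [Num g] [q] [j] [d] [e], pos) Q"
proof -
  let ?X = "\<lambda>q. substr sbar (Suc p) q"
  \<comment> \<open>The number of rounds: the least number of offline characters after which the
    loop guard fails. It is at most \<open>n - p\<close>, which gives termination.\<close>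
  define N where "N = (LEAST x. g \<le> lcs (?X (p + x)) w \<or> n \<le> p + x)"
  have N: "g \<le> lcs (?X (p + N)) w \<or> n \<le> p + N" unfolding N_def by (rule LeastI[of _ n]) simp
  have less: "lcs (?X (p + x)) w < g \<and> p + x < n" if "x < N" for x
    using not_less_Least[of x "\<lambda>x. g \<le> lcs (?X (p + x)) w \<or> n \<le> p + x"] that by (auto simp: N_def)
  have "N \<le> n - p" unfolding N_def by (rule Least_le) (use assms(3) in simp)
  then have Nn: "p + N \<le> n" using assms(3) by simp
  have ex: "lcs (?X q') w < g" if "p \<le> q'" "q' < p + N" for q'
    using less[of "q' - p"] that by simp
  have snoc: "?X (p + x) @ [sbar ! (p + x)] = ?X (Suc (p + x))" if "p + x < n" for x
    using that len by (simp add: substr_Suc take_Suc_conv_app_nth)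
  have fin: "Q (st D out (map Chr w) (lcs_row w (?X (p + N))) i k c b [Num p] [Num g] [Num (p + N)] [j] [d] [e], pos)"
    for j d e using assms(4)[of "p + N"] N Nn ex by fastforce
  have loop: "runs (While (Conj (Less (Cell 7 (var (Suc 0))) (var 13)) (Less (var 14) (var 0))) row_step)
      (st D out (map Chr w) (lcs_row w []) i k c b [Num p] [Num g] [Num p] [j] [d] [e], pos) Q" for j d e
  proof (rule runs_While[where N = N and Inv = "\<lambda>x y. \<exists>j d e. y = (st D out (map Chr w)
      (lcs_row w (?X (p + x))) i k c b [Num p] [Num g] [Num (p + x)] [j] [d] [e], pos)"])
    fix y assume "\<exists>j d e. y = (st D out (map Chr w)
      (lcs_row w (?X (p + N))) i k c b [Num p] [Num g] [Num (p + N)] [j] [d] [e], pos)"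
    then show "bval sbar (fst y) (Conj (Less (Cell 7 (var (Suc 0))) (var 13)) (Less (var 14) (var 0))) = Some False \<and> Q y"
      using N fin by (auto split: bool.splits simp: assms(1) nth_lcs_row)
  next
    fix x y assume "x < N" "\<exists>j d e. y = (st D out (map Chr w)
      (lcs_row w (?X (p + x))) i k c b [Num p] [Num g] [Num (p + x)] [j] [d] [e], pos)"
    then show "bval sbar (fst y) (Conj (Less (Cell 7 (var (Suc 0))) (var 13)) (Less (var 14) (var 0))) = Some True \<and>
       runs row_step y (\<lambda>y. \<exists>j d e. y = (st D out (map Chr w)
      (lcs_row w (?X (p + Suc x))) i k c b [Num p] [Num g] [Num (p + Suc x)] [j] [d] [e], pos))"
      using less[of x] snoc[of x] by (auto intro!: runs_row_step simp: assms(1) nth_lcs_row)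
  qed (simp add: substr_Suc)
  show ?thesis unfolding lcsp_prog_def
    using assms(2,3) by (auto intro!: runs_intros runs_reset_row[OF assms(1)] loop simp: len_cap_def val_cap_def)
qed

lemma f_val_le: "k \<le> K \<Longrightarrow> f k \<le> n"
  using pow_le_iff_le_K_max[of \<epsilon> n k] eps n(1) f_val_le_iff[OF eps, of k n] by simp

lemma runs_try_prog:
  assumes "substr s l r = w" "length w = m" "length row \<le> Suc m" "p \<le> n" "0 < g \<or> 1 \<le> p" "A \<noteq> enat 0"
    "\<And>row q j d e. length row \<le> Suc m \<Longrightarrow>
      Q (st D out (map Chr w) row i k c [Num (encode (min A (lcsp sbar s l r (Suc p) g)))]
        [Num p] [Num g] [q] [j] [d] [e], pos)"
  shows "runs try_prog
      (st D out (map Chr w) row i k c [Num (encode A)] [Num p] [Num g] [q] [j] [d] [e], pos) Q"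
  unfolding try_prog_def
proof (rule runs_block, rule runs_lcsp_prog[OF assms(2-4)])
  fix q j d e
  assume q: "p \<le> q" "q \<le> n" "g \<le> lcs (substr sbar (Suc p) q) w \<or> q = n"
    "\<And>q'. p \<le> q' \<Longrightarrow> q' < q \<Longrightarrow> lcs (substr sbar (Suc p) q') w < g"
  let ?st = "\<lambda>b. (st D out (map Chr w) (lcs_row w (substr sbar (Suc p) q)) i k c [Num b]
        [Num p] [Num g] [Num q] [j] [d] [e], pos)"
  show "runs (block [Cond (Less (Cell 7 (var (Suc 0))) (var 13)) Skip
      (Cond (Conj (Neg (Eq (var 11) (Const 0))) (Neg (Less (var 14) (var 11)))) Skip (set_var 11 (var 14)))])
      (?st (encode A)) Q"
  proof (cases "g \<le> lcs (substr sbar (Suc p) q) w")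
    case True
    have "lcsp sbar s l r (Suc p) g = enat q" using True q(1,2,4) len assms(1) by (intro lcsp_eq_enatI) auto
    then have fin: "Q (?st (if encode A \<noteq> 0 \<and> \<not> q < encode A then encode A else q))"
      using assms(7)[of "lcs_row w (substr sbar (Suc p) q)"] assms(6) by (simp add: encode_min_enat assms(2))
    show ?thesis using True fin q(2)
      by (auto intro!: runs_intros split: bool.splits if_splits simp: nth_lcs_row assms(2) len_cap_def val_cap_def)
  next
    case False
    \<comment> \<open>The search stopped at the end of the string, so no position reaches the
      target.\<close>
    then have "q = n" using q(3) by simp
    have "lcs (substr sbar (Suc p) q') w < g" if "p \<le> q'" "q' \<le> n" for q'
      using that q(4)[of q'] False \<open>q = n\<close> by (cases "q' = n") auto
    then have "lcsp sbar s l r (Suc p) g = \<infinity>" using assms(1,4) len by (intro lcsp_eq_infinityI) auto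
    then have fin: "Q (?st (encode A))"
      using assms(7)[of "lcs_row w (substr sbar (Suc p) q)"] by (simp add: assms(2))
    show ?thesis using False fin
      by (auto intro!: runs_intros split: bool.splits if_splits simp: nth_lcs_row assms(2))
  qed
qed

lemma candidate_nonzero:
  assumes "\<And>k p. D k = enat p \<Longrightarrow> 1 \<le> p \<and> p \<le> n"
  shows "candidate \<epsilon> sbar s l r D k c \<noteq> enat 0"
proof
  assume *: "candidate \<epsilon> sbar s l r D k c = enat 0"
  then consider "lcsp sbar s l r (Suc 0) (f k) = enat 0"
    | k1 p where "D k1 = enat p" "lcsp sbar s l r (Suc p) (f k - f k1) = enat 0"
    by (auto simp: candidate_def split: nat.splits enat.splits)
  then show False
  proof cases
    case 1 then show ?thesis using lcsp_range[of sbar s l r 0 "f k" 0] f_val_pos[OF eps, of k] by simp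
  next
    case 2 then show ?thesis using lcsp_range[OF 2(2)] assms[OF 2(1)] len by simp
  qed
qed

lemma Inf_candidate_nonzero:
  assumes "\<And>k p. D k = enat p \<Longrightarrow> 1 \<le> p \<and> p \<le> n"
  shows "Inf (candidate \<epsilon> sbar s l r D k ` C) \<noteq> enat 0"
proof
  assume *: "Inf (candidate \<epsilon> sbar s l r D k ` C) = enat 0"
  then have "C \<noteq> {}" by (auto simp: top_enat_def)
  then have "enat 0 \<in> candidate \<epsilon> sbar s l r D k ` C" using enat_Inf_mem[of "candidate \<epsilon> sbar s l r D k ` C"] * by simp
  then obtain c where "candidate \<epsilon> sbar s l r D k c = enat 0" by (metis imageE)
  moreover have "candidate \<epsilon> sbar s l r D k c \<noteq> enat 0" by (rule candidate_nonzero) (rule assms)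
  ultimately show False by contradiction
qed

text \<open>\<open>E\<close> is the array in memory, \<open>D\<close> the array before the window.
  They have to agree only up to \<open>k\<close>, as no other entries are read for entry
  \<open>k\<close>.\<close>

lemma runs_candidate_prog:
  assumes w: "substr s l r = w" "length w = m" and row: "length row \<le> Suc m"
    and D: "\<And>k p. D k = enat p \<Longrightarrow> 1 \<le> p \<and> p \<le> n"
    and E: "\<And>x. x \<le> k \<Longrightarrow> E x = D x"
    and k: "k \<le> K" "c \<le> Suc k"
    and A: "A \<noteq> enat 0"
    and Q: "\<And>row p g q j d e. length row \<le> Suc m \<Longrightarrow>
      Q (st (map (\<lambda>x. Num (encode (E x))) [0..<Suc K]) out (map Chr w) row i [Num k] [Num (Suc c)]
        [Num (encode (min A (candidate \<epsilon> sbar s l r D k c)))] [p] [g] [q] [j] [d] [e], pos)"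
  shows "runs candidate_prog
     (st (map (\<lambda>x. Num (encode (E x))) [0..<Suc K]) out (map Chr w) row i [Num k] [Num c]
        [Num (encode A)] [p] [g] [q] [j] [d] [e], pos) Q"
proof -
  have fk: "f k \<le> n" "f k - x \<le> n + K + 3" "f k \<le> n + K + 3" "0 < f k" for x
    using f_val_le[OF k(1)] f_val_pos[OF eps, of k] by auto
  show ?thesis
  proof (cases c)
    case 0
    have "candidate \<epsilon> sbar s l r D k 0 = lcsp sbar s l r (Suc 0) (f k)" by (simp add: candidate_def)
    then show ?thesis unfolding candidate_prog_def 0
      using k(1) fk Q[unfolded 0] A
      by (auto intro!: runs_intros runs_try_prog[OF w row] simp: len_cap_def val_cap_def simp del: upt_Suc)
  next
    case (Suc k1)
    have Ek: "E k1 = D k1" using E k Suc by simp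
    have k1: "k1 \<le> K" "k1 \<le> k" using k Suc by simp_all
    show ?thesis
    proof (cases "D k1")
      case (enat p')
      have "candidate \<epsilon> sbar s l r D k (Suc k1) = lcsp sbar s l r (Suc p') (f k - f k1)"
        using enat by (simp add: candidate_def)
      then show ?thesis unfolding candidate_prog_def Suc
        using k(1) k1 fk Q[unfolded Suc] A D[OF enat] Ek enat
        by (auto intro!: runs_intros runs_try_prog[OF w row] simp: len_cap_def val_cap_def simp del: upt_Suc)
    next
      case infinity
      have "candidate \<epsilon> sbar s l r D k (Suc k1) = \<infinity>" using infinity by (simp add: candidate_def)
      then show ?thesis unfolding candidate_prog_def Suc
        using k(1) k1 fk Q[unfolded Suc] A Ek infinity row
        by (auto intro!: runs_intros simp: len_cap_def val_cap_def simp del: upt_Suc)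
    qed
  qed
qed

lemma runs_entry_prog:
  assumes w: "substr s l r = w" "length w = m" and row: "length row \<le> Suc m"
    and D: "\<And>k p. D k = enat p \<Longrightarrow> 1 \<le> p \<and> p \<le> n"
    and E: "\<And>x. x \<le> k \<Longrightarrow> E x = D x"
    and k: "k \<le> K"
    and Q: "\<And>row c b p g q j d e. length row \<le> Suc m \<Longrightarrow>
      Q (st (map (\<lambda>x. Num (encode ((E(k := new_array \<epsilon> sbar s l r D k)) x))) [0..<Suc K]) out (map Chr w) row
        i [Num k] [c] [b] [p] [g] [q] [j] [d] [e], pos)"
  shows "runs entry_prog
     (st (map (\<lambda>x. Num (encode (E x))) [0..<Suc K]) out (map Chr w) row i [Num (Suc k)] [c]
        [b] [p] [g] [q] [j] [d] [e], pos) Q"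
proof -
  \<comment> \<open>Best value after \<open>c\<close> candidates. For \<open>c = 0\<close> the
    infimum is \<open>\<infinity>\<close>, coded by the initial 0.\<close>
  let ?A = "\<lambda>c. Inf (candidate \<epsilon> sbar s l r D k ` {..<c})"
  let ?D = "map (\<lambda>x. Num (encode (E x))) [0..<Suc K]"
  have A: "?A c \<noteq> enat 0" for c by (rule Inf_candidate_nonzero) (rule D)
  have step: "min (?A c) (candidate \<epsilon> sbar s l r D k c) = ?A (Suc c)" for c
    by (simp add: lessThan_Suc inf_min min.commute)
  have range: "encode (new_array \<epsilon> sbar s l r D k) \<le> n"
    using new_array_range[of \<epsilon> D sbar s l r k] eps D len by (cases "new_array \<epsilon> sbar s l r D k") auto
  have write_at: "write_at ?D k (Num (encode T)) = map (\<lambda>x. Num (encode ((E(k := T)) x))) [0..<Suc K]" for T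
    using k by (auto simp: write_at_map_upt simp del: upt_Suc)
  have loop: "runs (While (Less (var 10) (Plus (var 9) (Const 2))) candidate_prog)
     (st ?D out (map Chr w) row i [Num k] [Num 0] [Num 0] [p] [g] [q] [j] [d] [e], pos)
     (\<lambda>y. runs (block [Put 4 (var 9) (var 11)]) y Q)"
    for p g q j d e
  proof (rule runs_While[where N = "k + 2" and Inv = "\<lambda>c y. \<exists>row p g q j d e. length row \<le> Suc m \<and>
     y = (st ?D out (map Chr w) row i [Num k] [Num c] [Num (encode (?A c))] [p] [g] [q] [j] [d] [e], pos)"])
    show "\<exists>row' p' g' q' j' d' e'. length row' \<le> Suc m \<and>
      (st ?D out (map Chr w) row i [Num k] [Num 0] [Num 0] [p] [g] [q] [j] [d] [e], pos) =
      (st ?D out (map Chr w) row' i [Num k] [Num 0] [Num (encode (?A 0))] [p'] [g'] [q'] [j'] [d'] [e'], pos)"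
      using row by (auto simp: top_enat_def)
  next
    fix c y assume c: "c < k + 2" and "\<exists>row p g q j d e. length row \<le> Suc m \<and>
      y = (st ?D out (map Chr w) row i [Num k] [Num c] [Num (encode (?A c))] [p] [g] [q] [j] [d] [e], pos)"
    then obtain row p g q j d e where y: "length row \<le> Suc m"
      "y = (st ?D out (map Chr w) row i [Num k] [Num c] [Num (encode (?A c))] [p] [g] [q] [j] [d] [e], pos)"
      by blast
    have "runs candidate_prog y (\<lambda>y. \<exists>row p g q j d e. length row \<le> Suc m \<and>
      y = (st ?D out (map Chr w) row i [Num k] [Num (Suc c)] [Num (encode (?A (Suc c)))] [p] [g] [q] [j] [d] [e], pos))"
      unfolding y(2) by (rule runs_candidate_prog[OF w y(1), where D = D])
        (use D E k c A in \<open>auto simp: step simp del: upt_Suc\<close>)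
    then show "bval sbar (fst y) (Less (var 10) (Plus (var 9) (Const 2))) = Some True \<and>
      runs candidate_prog y (\<lambda>y. \<exists>row p g q j d e. length row \<le> Suc m \<and>
      y = (st ?D out (map Chr w) row i [Num k] [Num (Suc c)] [Num (encode (?A (Suc c)))] [p] [g] [q] [j] [d] [e], pos))"
      using c by (simp add: y(2))
  next
    fix y assume "\<exists>row p g q j d e. length row \<le> Suc m \<and>
      y = (st ?D out (map Chr w) row i [Num k] [Num (k + 2)] [Num (encode (?A (k + 2)))] [p] [g] [q] [j] [d] [e], pos)"
    then show "bval sbar (fst y) (Less (var 10) (Plus (var 9) (Const 2))) = Some False \<and>
       runs (block [Put 4 (var 9) (var 11)]) y Q"
      unfolding new_array_eq_Inf_candidate[symmetric] using k Q range
      by (auto intro!: runs_intros simp: len_cap_def val_cap_def write_at simp del: upt_Suc fun_upd_apply)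
  qed
  show ?thesis unfolding entry_prog_def using k
    by (auto intro!: runs_intros loop simp: len_cap_def val_cap_def simp del: upt_Suc)
qed

lemma runs_update_array:
  assumes w: "substr s l r = w" "length w = m" and row: "length row \<le> Suc m"
    and D: "\<And>k p. D k = enat p \<Longrightarrow> 1 \<le> p \<and> p \<le> n"
    and Q: "\<And>row k c b p g q j d e. length row \<le> Suc m \<Longrightarrow>
      Q (st (map (\<lambda>x. Num (encode (new_array \<epsilon> sbar s l r D x))) [0..<Suc K]) out (map Chr w) row
        i [k] [c] [b] [p] [g] [q] [j] [d] [e], pos)"
  shows "runs (While (Less (Const 0) (var 9)) entry_prog)
     (st (map (\<lambda>x. Num (encode (D x))) [0..<Suc K]) out (map Chr w) row i [Num (Suc K)] [c]
        [b] [p] [g] [q] [j] [d] [e], pos) Q"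
proof -
  \<comment> \<open>After \<open>a\<close> rounds the \<open>a\<close> largest indices hold new
    values. The next one, \<open>K - a\<close>, depends only on old entries up to itself, so no
    second array is needed.\<close>
  let ?E = "\<lambda>a x. if x + a < Suc K then D x else new_array \<epsilon> sbar s l r D x"
  let ?Inv = "\<lambda>a y. \<exists>row c b p g q j d e. length row \<le> Suc m \<and>
     y = (st (map (\<lambda>x. Num (encode (?E a x))) [0..<Suc K]) out (map Chr w) row i [Num (Suc K - a)] [c] [b] [p] [g] [q] [j] [d] [e], pos)"
  have upd: "map (\<lambda>x. Num (encode (((?E a)(K - a := new_array \<epsilon> sbar s l r D (K - a))) x))) [0..<Suc K] =
      map (\<lambda>x. Num (encode (?E (Suc a) x))) [0..<Suc K]" if "a < Suc K" for a
    using that by (auto simp del: upt_Suc)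
  show ?thesis
  proof (rule runs_While[where N = "Suc K" and Inv = ?Inv])
    show "?Inv 0 (st (map (\<lambda>x. Num (encode (D x))) [0..<Suc K]) out (map Chr w) row i [Num (Suc K)] [c]
        [b] [p] [g] [q] [j] [d] [e], pos)" using row by (auto simp del: upt_Suc)
  next
    fix a y assume a: "a < Suc K" and inv: "?Inv a y"
    have Suc_diff: "Suc K - a = Suc (K - a)" using a by simp
    obtain row c b p g q j d e where y: "length row \<le> Suc m"
     "y = (st (map (\<lambda>x. Num (encode (?E a x))) [0..<Suc K]) out (map Chr w) row i [Num (Suc (K - a))] [c] [b] [p] [g] [q] [j] [d] [e], pos)"
      using inv unfolding Suc_diff by blast
    have "runs entry_prog y (?Inv (Suc a))"
      unfolding y(2)
    proof (rule runs_entry_prog[OF w y(1), where D = D], goal_cases)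
      case (4 row c b p g q j d e)
      show ?case unfolding upd[OF a] using 4 by (auto simp del: upt_Suc)
    qed (use D a in auto)
    then show "bval sbar (fst y) (Less (Const 0) (var 9)) = Some True \<and> runs entry_prog y (?Inv (Suc a))"
      by (simp add: y(2) del: upt_Suc)
  next
    fix y assume "?Inv (Suc K) y"
    then show "bval sbar (fst y) (Less (Const 0) (var 9)) = Some False \<and> Q y"
      using Q by (auto simp del: upt_Suc)
  qed
qed

lemma runs_read_window:
  assumes "length win \<le> m" "pos + m \<le> n"
    "Q (st D out (map Chr (take m (drop pos s))) row i k c b p g q [Num m] d e, pos + m)"
  shows "runs (While (Less (var 15) (var (Suc 0))) (block [Next 6 (var 15), incr 15]))
     (st D out win row i k c b p g q [Num 0] d e, pos) Q"
proof (rule runs_While[where N = m and Inv = "\<lambda>j y. \<exists>R. j \<le> length R \<and> length R \<le> m \<and>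
      take j R = map Chr (take j (drop pos s)) \<and> y = (st D out R row i k c b p g q [Num j] d e, pos + j)"])
  fix j y
  assume j: "j < m" and "\<exists>R. j \<le> length R \<and> length R \<le> m \<and>
      take j R = map Chr (take j (drop pos s)) \<and> y = (st D out R row i k c b p g q [Num j] d e, pos + j)"
  moreover have "take (Suc j) (drop pos s) = take j (drop pos s) @ [s ! (pos + j)]"
    using j assms(2) len by (simp add: take_Suc_conv_app_nth)
  ultimately show "bval sbar (fst y) (Less (var 15) (var (Suc 0))) = Some True \<and>
    runs (block [Next 6 (var 15), incr 15]) y (\<lambda>y. \<exists>R. Suc j \<le> length R \<and> length R \<le> m \<and>
      take (Suc j) R = map Chr (take (Suc j) (drop pos s)) \<and>
      y = (st D out R row i k c b p g q [Num (Suc j)] d e, pos + Suc j))"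
    using m_bounds assms(2) by (auto intro!: runs_intros simp: len len_cap_def val_cap_def length_write_at take_write_at)
next
  fix y assume "\<exists>R. m \<le> length R \<and> length R \<le> m \<and>
      take m R = map Chr (take m (drop pos s)) \<and> y = (st D out R row i k c b p g q [Num m] d e, pos + m)"
  then have "y = (st D out (map Chr (take m (drop pos s))) row i k c b p g q [Num m] d e, pos + m)"
    by (metis take_all)
  then show "bval sbar (fst y) (Less (var 15) (var (Suc 0))) = Some False \<and> Q y" using assms(3) by simp
qed (use assms in auto)

lemma runs_window_prog:
  assumes i: "i < m" and arrays: "length win \<le> m" "length row \<le> Suc m"
    and Q: "\<And>win row k c b p g q j d e. length win \<le> m \<Longrightarrow> length row \<le> Suc m \<Longrightarrow>
      Q (st (map (\<lambda>x. Num (encode (D_array \<epsilon> m sbar s (Suc i) x))) [0..<Suc K]) out win row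
        [Num (Suc i)] [k] [c] [b] [p] [g] [q] [j] [d] [e], Suc i * m)"
  shows "runs window_prog (st (map (\<lambda>x. Num (encode (D_array \<epsilon> m sbar s i x))) [0..<Suc K]) out win row
        [Num i] [k] [c] [b] [p] [g] [q] [j] [d] [e], i * m) Q"
proof -
  let ?w = "take m (drop (i * m) s)"
  have "Suc i * m \<le> m * m" using i by (intro mult_right_mono) auto
  then have im: "i * m + m \<le> n" using n(2) by (simp add: power2_eq_square)
  have w: "substr s (i * m + 1) (Suc i * m) = ?w" by (simp add: substr_def)
  have lw: "length ?w = m" using im len by simp
  have D: "1 \<le> p \<and> p \<le> n" if "D_array \<epsilon> m sbar s i k = enat p" for k p
    using D_array_range[OF eps that] len by simp
  show ?thesis unfolding window_prog_def
    using i arrays m_bounds im Q lw D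
    by (auto intro!: runs_intros runs_read_window runs_update_array[OF w lw, where D = "D_array \<epsilon> m sbar s i"]
       simp: len_cap_def val_cap_def add.commute[of "i * m" m] simp del: upt_Suc)
qed

lemma runs_init_prog:
  assumes "Q (st (map (\<lambda>x. Num (encode (D_array \<epsilon> m sbar s 0 x))) [0..<Suc K]) [Num 0] [] []
        [Num 0] [Num 0] [Num 0] [Num 0] [Num 0] [Num 0] [Num 0] [Num (Suc K)] [Num 0] [Num 0], 0)"
  shows "runs init_prog (initial_store \<epsilon> n m 12, 0) Q"
proof -
  have init: "initial_store \<epsilon> n m 12 = st [] [] [] [] [] [] [] [] [] [] [] [] [] []"
    by (simp add: initial_store_def st_def eval_nat_numeral)
  have zeros: "map (\<lambda>x. Num (encode (D_array \<epsilon> m sbar s 0 x))) [0..<Suc K] = replicate (Suc K) (Num 0)"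
    by (simp add: map_replicate_const del: upt_Suc replicate_Suc)
  have loop: "runs (While (Less (var 15) (Plus (var 2) (Const (Suc 0)))) (block [Put 4 (var 15) (Const 0), incr 15]))
      (st [] [Num 0] [] [] [Num 0] [Num 0] [Num 0] [Num 0] [Num 0] [Num 0] [Num 0] [Num 0] [Num 0] [Num 0], 0) Q"
  proof (rule runs_While[where N = "Suc K" and Inv = "\<lambda>j y. y = (st (replicate j (Num 0)) [Num 0] [] []
        [Num 0] [Num 0] [Num 0] [Num 0] [Num 0] [Num 0] [Num 0] [Num j] [Num 0] [Num 0], 0)"])
    fix j and y :: "'a config"
    assume "j < Suc K" "y = (st (replicate j (Num 0)) [Num 0] [] []
        [Num 0] [Num 0] [Num 0] [Num 0] [Num 0] [Num 0] [Num 0] [Num j] [Num 0] [Num 0], 0)"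
    then show "bval sbar (fst y) (Less (var 15) (Plus (var 2) (Const (Suc 0)))) = Some True \<and>
      runs (block [Put 4 (var 15) (Const 0), incr 15]) y (\<lambda>y. y = (st (replicate (Suc j) (Num 0)) [Num 0] [] []
        [Num 0] [Num 0] [Num 0] [Num 0] [Num 0] [Num 0] [Num 0] [Num (Suc j)] [Num 0] [Num 0], 0))"
      by (auto intro!: runs_intros simp: len_cap_def val_cap_def write_at_def replicate_append_same)
  qed (use assms[unfolded zeros] in auto)
  show ?thesis unfolding init_prog_def init
    by (auto intro!: runs_intros loop simp: len_cap_def val_cap_def)
qed

section \<open>Reading off the output\<close>

definition best_upto :: "(nat \<Rightarrow> enat) \<Rightarrow> nat \<Rightarrow> nat" where
  "best_upto D k = Max (insert 0 (f ` {x. x < k \<and> D x < \<infinity>}))"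

lemma best_upto_0: "best_upto D 0 = 0"
  by (simp add: best_upto_def)

text \<open>Values of \<open>f\<close> are nondecreasing, so a finite entry \<open>k\<close>
  supersedes all earlier ones. The 0 inserted into the maximum covers the case of no finite
  entry.\<close>

lemma best_upto_Suc: "best_upto D (Suc k) = (if D k < \<infinity> then f k else best_upto D k)"
proof -
  have "{x. x < Suc k \<and> D x < \<infinity>} =
      (if D k < \<infinity> then insert k {x. x < k \<and> D x < \<infinity>} else {x. x < k \<and> D x < \<infinity>})"
    by (auto simp: less_Suc_eq)
  moreover have "Max (insert (f k) (insert 0 (f ` {x. x < k \<and> D x < \<infinity>}))) = f k"
    using f_val_mono[OF eps] by (intro Max_eqI) auto
  ultimately show ?thesis by (auto simp: best_upto_def insert_commute)
qed

lemma alg_output_eq: "alg_output \<epsilon> m sbar s = best_upto (D_array \<epsilon> m sbar s m) (Suc K)"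
proof -
  let ?F = "{x. x \<le> K \<and> D_array \<epsilon> m sbar s m x < \<infinity>}"
  have "Max (insert 0 (f ` ?F)) = Max (f ` ?F)" if "?F \<noteq> {}"
    using that by (subst Max_insert) auto
  moreover have "alg_output \<epsilon> m sbar s = (if ?F = {} then 0 else Max (f ` ?F))"
    unfolding alg_output_def Let_def len(2) by (rule refl)
  moreover have "best_upto (D_array \<epsilon> m sbar s m) (Suc K) = Max (insert 0 (f ` ?F))"
    unfolding best_upto_def less_Suc_eq_le by (rule refl)
  moreover have "Max (insert 0 (f ` ?F)) = 0" if "?F = {}" unfolding that by simp
  ultimately show ?thesis by (metis (no_types))
qed

lemma runs_output_prog:
  assumes D: "\<And>k p. D k = enat p \<Longrightarrow> 1 \<le> p"
    and Q: "\<And>k. Q (st (map (\<lambda>x. Num (encode (D x))) [0..<Suc K]) [Num (best_upto D (Suc K))] win row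
        i [k] c b p g q j d e, pos)"
  shows "runs output_prog (st (map (\<lambda>x. Num (encode (D x))) [0..<Suc K]) [Num 0] win row
        i [k] c b p g q j d e, pos) Q"
proof -
  let ?D = "map (\<lambda>x. Num (encode (D x))) [0..<Suc K]"
  have pos_iff: "0 < encode (D x) \<longleftrightarrow> D x < \<infinity>" for x using D[of x] by (cases "D x") auto
  have loop: "runs (While (Less (var 9) (Plus (var 2) (Const (Suc 0))))
       (block [Cond (Less (Const 0) (Cell 4 (var 9))) (set_var 5 (Cell 3 (var 9))) Skip, incr 9]))
       (st ?D [Num 0] win row i [Num 0] c b p g q j d e, pos) Q"
  proof (rule runs_While[where N = "Suc K" and
        Inv = "\<lambda>k y. y = (st ?D [Num (best_upto D k)] win row i [Num k] c b p g q j d e, pos)"])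
    fix k y
    assume k: "k < Suc K" "y = (st ?D [Num (best_upto D k)] win row i [Num k] c b p g q j d e, pos)"
    then have "f k \<le> n + K + 3" "D k \<noteq> enat 0" using f_val_le[of k] D[of k 0] by auto
    with k show "bval sbar (fst y) (Less (var 9) (Plus (var 2) (Const (Suc 0)))) = Some True \<and>
       runs (block [Cond (Less (Const 0) (Cell 4 (var 9))) (set_var 5 (Cell 3 (var 9))) Skip, incr 9]) y
         (\<lambda>y. y = (st ?D [Num (best_upto D (Suc k))] win row i [Num (Suc k)] c b p g q j d e, pos))"
      by (auto intro!: runs_intros simp: len_cap_def val_cap_def pos_iff best_upto_Suc simp del: upt_Suc)
  qed (use Q in \<open>auto simp: best_upto_0 simp del: upt_Suc\<close>)
  show ?thesis unfolding output_prog_def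
    by (auto intro!: runs_intros loop simp: len_cap_def val_cap_def simp del: upt_Suc)
qed

end

section \<open>Memory consumption\<close>

lemma exec_length_store:
  "exec sbar s c x t y \<Longrightarrow> length (fst y) = length (fst x) \<and> (\<forall>z\<in>set t. length (fst z) = length (fst x))"
  by (induction rule: exec.induct) (auto simp: put_cell_def split: if_splits)

lemma cell_size_le: "cell_le c v \<Longrightarrow> cell_size c \<le> 1 + floorlog 2 v"
  by (cases c) (auto intro: floorlog_mono)

lemma memory_le_of_bounded_store:
  assumes "bounded_store L V M"
  shows "memory M \<le> (\<Sum>a<length M. L a * (1 + floorlog 2 (V a)))"
proof -
  have "sum_list (map cell_size (M ! a)) \<le> L a * (1 + floorlog 2 (V a))" if "a < length M" for a
  proof -
    have a: "length (M ! a) \<le> L a" "\<forall>c\<in>set (M ! a). cell_le c (V a)"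
      using assms that by (auto simp: bounded_store_def)
    have "sum_list (map cell_size (M ! a)) \<le> sum_list (map (\<lambda>_. 1 + floorlog 2 (V a)) (M ! a))"
      using a(2) cell_size_le by (intro sum_list_mono) auto
    also have "\<dots> = length (M ! a) * (1 + floorlog 2 (V a))" by (simp add: sum_list_triv)
    also have "\<dots> \<le> L a * (1 + floorlog 2 (V a))" using a(1) by (intro mult_right_mono) auto
    finally show ?thesis .
  qed
  then have "(\<Sum>a<length M. sum_list (map cell_size (M ! a))) \<le> (\<Sum>a<length M. L a * (1 + floorlog 2 (V a)))"
    by (intro sum_mono) (simp only: lessThan_iff)
  moreover have "memory M = (\<Sum>a<length M. sum_list (map cell_size (M ! a)))"
    unfolding memory_def by (subst sum_list_sum_nth) (simp add: atLeast0LessThan)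
  ultimately show ?thesis by simp
qed

text \<open>With \<open>l\<close> the binary length of \<open>a\<close>,
  \<open>a + b < 2 ^ l * (1 + b) \<le> 2 ^ (l + b)\<close>. For counters up to
  \<open>n + K + 3\<close> this lets \<open>K\<close> enter additively, as the claimed memory bound
  permits.\<close>

lemma floorlog_add_le: "floorlog 2 (a + b) \<le> floorlog 2 a + b"
proof (rule floorlog_leI)
  have "a < 2 ^ floorlog 2 a"
    using floorlog_bounds[of a 2] by (cases "a = 0") (auto simp: floorlog_eq_zero_iff[THEN iffD2])
  then have "a + b < 2 ^ floorlog 2 a + b" by simp
  also have "\<dots> \<le> 2 ^ floorlog 2 a * (1 + b)" by simp
  also have "\<dots> \<le> 2 ^ floorlog 2 a * 2 ^ b" by (intro mult_left_mono) (auto simp: Suc_le_eq)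
  finally show "a + b < 2 ^ (floorlog 2 a + b)" by (simp add: power_add)
qed auto

context lcs_run
begin

text \<open>Each of the 18 arrays takes at most \<open>2 * (?W * ?S)\<close>: a long one has at most
  \<open>?W\<close> cells of size at most \<open>?S\<close>, a single cell has size at most
  \<open>?S + (K + 3)\<close>. Hence the constant 36.\<close>

lemma memory_le:
  assumes "bounded z" "length (fst z) = 18"
  shows "memory (fst z) \<le> 36 * ((m + K + 3) * (1 + floorlog 2 n))"
proof -
  let ?W = "m + K + 3" and ?S = "1 + floorlog 2 n"
  have "len_cap a * (1 + floorlog 2 (val_cap a)) \<le> 2 * (?W * ?S)" for a
  proof (cases "a \<in> {3, 4, 6, 7}")
    case False
    have "1 + floorlog 2 (n + (K + 3)) \<le> ?S + (K + 3)" using floorlog_add_le[of n "K + 3"] by simp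
    also have "\<dots> \<le> 2 * (?W * ?S)" by (simp add: algebra_simps)
    finally show ?thesis using False by (simp add: len_cap_def val_cap_def add.assoc)
  qed (simp add: len_cap_def val_cap_def)
  then have "(\<Sum>a<length (fst z). len_cap a * (1 + floorlog 2 (val_cap a))) \<le> length (fst z) * (2 * (?W * ?S))"
    using sum_bounded_above[of "{..<length (fst z)}" _ "2 * (?W * ?S)"] by simp
  then show ?thesis using memory_le_of_bounded_store[of len_cap val_cap "fst z"] assms
    by (simp add: bounded_def)
qed

lemma bounded_initial: "bounded (initial_store \<epsilon> n m 12, 0)"
  using f_val_le m_bounds
  by (auto simp: bounded_def bounded_store_def initial_store_def len_cap_def val_cap_def nth_append less_Suc_eq
      numeral_eq_Suc)

text \<open>Assembled from three executions, since the postcondition of \<open>runs\<close> forgets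
  the configurations passed on the way, and the arrays after each window must be exhibited.\<close>

lemma main_prog_implements:
  "implements_within main_prog 12 \<epsilon> m sbar s (real (36 * ((m + K + 3) * (1 + floorlog 2 n))))"
proof -
  let ?x = "(initial_store \<epsilon> n m 12, 0) :: 'a config"
  let ?D = "\<lambda>i. map (\<lambda>x. Num (encode (D_array \<epsilon> m sbar s i x))) [0..<Suc K] :: 'a cell list"
  let ?Inv = "\<lambda>i y. \<exists>win row k c b p g q j d e. length win \<le> m \<and> length row \<le> Suc m \<and>
      y = (st (?D i) [Num 0] win row [Num i] [k] [c] [b] [p] [g] [q] [j] [d] [e], i * m)"
  have "runs init_prog ?x (?Inv 0)"
    by (rule runs_init_prog) (auto simp del: upt_Suc)
  then obtain t0 y0 where t0: "exec sbar s init_prog ?x t0 y0" "\<forall>z\<in>set t0. bounded z" "?Inv 0 y0"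
    using bounded_initial unfolding runs_def by blast
  \<comment> \<open>The array for zero windows has to occur in the trace, which does not list the
    start configuration; array 4 has been filled, so initialization took at least one step.\<close>
  have y0: "y0 \<in> set t0"
  proof -
    have "fst y0 ! 4 \<noteq> []" using t0(3) by auto
    moreover have "fst ?x ! 4 = []" by (simp add: initial_store_def)
    ultimately have "y0 \<noteq> ?x" by auto
    then show ?thesis using exec_final_mem[OF t0(1)] by simp
  qed
  have step: "bval sbar (fst y) (Less (var 8) (var (Suc 0))) = Some True \<and> runs window_prog y (?Inv (Suc i))"
    if im: "i < m" and inv: "?Inv i y" for i y
  proof -
    obtain win row k c b p g q j d e where y: "length win \<le> m" "length row \<le> Suc m"
      "y = (st (?D i) [Num 0] win row [Num i] [k] [c] [b] [p] [g] [q] [j] [d] [e], i * m)"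
      using inv by blast
    have "runs window_prog y (?Inv (Suc i))" unfolding y(3)
      by (rule runs_window_prog[OF im y(1,2)]) blast
    then show ?thesis using im by (simp add: y(3) del: upt_Suc D_array.simps)
  qed
  have exit: "bval sbar (fst y) (Less (var 8) (var (Suc 0))) = Some False" if "?Inv m y" for y
    using that by (auto simp del: upt_Suc)
  have "bounded y0" using t0(2) y0 by blast
  then obtain t1 y1 where t1: "exec sbar s (While (Less (var 8) (var (Suc 0))) window_prog) y0 t1 y1"
      "\<forall>z\<in>set t1. bounded z" "?Inv m y1" "\<forall>i. 0 \<le> i \<and> i \<le> m \<longrightarrow> (\<exists>z\<in>set (y0 # t1). ?Inv i z)"
    using exec_While[where Inv = ?Inv and N = m and i = 0, OF step exit _ le0 t0(3)] by blast
  have y1: "bounded y1" using exec_final_mem[OF t1(1)] t1(2) t0(2) y0 by auto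
  obtain win row k c b p g q j d e where
    y1': "y1 = (st (?D m) [Num 0] win row [Num m] [k] [c] [b] [p] [g] [q] [j] [d] [e], m * m)"
    using t1(3) by blast
  have "runs output_prog y1 (\<lambda>y. fst y ! 5 = [Num (alg_output \<epsilon> m sbar s)])"
    unfolding y1' alg_output_eq by (intro runs_output_prog) (auto dest!: D_array_range[OF eps] simp del: upt_Suc)
  then obtain t2 y2 where t2: "exec sbar s output_prog y1 t2 y2" "\<forall>z\<in>set t2. bounded z"
      "fst y2 ! 5 = [Num (alg_output \<epsilon> m sbar s)]"
    using y1 unfolding runs_def by blast
  have ex: "exec sbar s main_prog ?x (t0 @ t1 @ t2) y2"
    unfolding main_prog_def by (rule exec.Seq[OF t0(1) exec.Seq[OF t1(1) t2(1)]])
  have "real (memory (fst z)) \<le> real (36 * ((m + K + 3) * (1 + floorlog 2 n)))" if "z \<in> set (?x # t0 @ t1 @ t2)" for z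
  proof -
    have "bounded z" using that bounded_initial t0(2) t1(2) t2(2) by auto
    moreover have "length (fst z) = 18"
      using that exec_length_store[OF ex] by (auto simp: initial_store_def)
    ultimately show ?thesis using memory_le of_nat_le_iff by blast
  qed
  moreover have "\<exists>z\<in>set (t0 @ t1 @ t2). snd z = i * m \<and>
      fst z ! 4 = map (\<lambda>k. entry_cell (D_array \<epsilon> m sbar s i k)) [0..<Suc K]" if im: "i \<le> m" for i
  proof -
    have "\<exists>z\<in>set (y0 # t1). ?Inv i z" using im by (intro t1(4)[rule_format] conjI le0)
    then obtain z where z: "z \<in> set (y0 # t1)" "?Inv i z" by (rule bexE)
    then have "snd z = i * m \<and> fst z ! 4 = ?D i" by (auto simp del: upt_Suc)
    then show ?thesis using z(1) y0 by (intro bexI[of _ z]) (auto simp: entry_cell_encode simp del: upt_Suc)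
  qed
  ultimately show ?thesis unfolding implements_within_def Let_def len(2) using ex t2(3) by blast
qed

text \<open>\<open>m + K + 3\<close> is at most 4 times the sum, as \<open>3 \<le> 3 * m\<close>;
  and \<open>1 + floorlog 2 n\<close> is at most \<open>2 + log 2 n\<close>, hence at most
  \<open>4 * ln n\<close>. The constant is \<open>36 * 4 * 4\<close>.\<close>

lemma memory_bound:
  "real (36 * ((m + K + 3) * (1 + floorlog 2 n))) \<le>
    576 * (sqrt (real n) + log (1 + \<epsilon>) (real n)) * ln (real n) ^ 1"
proof -
  let ?l = "log (1 + \<epsilon>) (real n)"
  have sqrt: "sqrt (real n) = real m" using n(2) by simp
  have m1: "1 \<le> real m" using m_bounds(1) by simp
  have l0: "0 \<le> ?l" using eps n(1) by simp
  then have "real K \<le> ?l" unfolding K_max_def by (simp add: of_nat_nat)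
  then have W: "real (m + K + 3) \<le> 4 * (sqrt (real n) + ?l)" using m1 l0 sqrt by simp
  have "ln (1 / 2 :: real) \<le> 1 / 2 - 1" by (intro ln_le_minus_one) simp
  then have ln2: "1 / 2 \<le> ln (2 :: real)" by (simp add: ln_div)
  \<comment> \<open>A square that is at least 2 is at least 4, and \<open>ln 4 \<ge> 1\<close> lets
    the logarithm absorb additive constants.\<close>
  have "2 \<le> m" using n by (cases "m = 1") (use m_bounds in auto)
  then have "2 ^ 2 \<le> n" unfolding n(2) by (intro power_mono) auto
  then have "ln (2 ^ 2) \<le> ln (real n)" by simp
  then have ln1: "1 \<le> ln (real n)" using ln2 ln_realpow[of "2 :: real" 2] by simp
  have "real (floorlog 2 n) \<le> log 2 (real n) + 1"
    using n(1) by (simp add: floorlog_def of_nat_nat)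
  moreover have "log 2 (real n) \<le> 2 * ln (real n)"
    using ln1 ln2 mult_right_mono[of 1 "2 * ln (2 :: real)" "ln (real n)"]
    by (simp add: log_def divide_le_eq mult.commute mult.left_commute)
  ultimately have S: "real (1 + floorlog 2 n) \<le> 4 * ln (real n)" using ln1 by simp
  have "real (m + K + 3) * real (1 + floorlog 2 n) \<le> (4 * (sqrt (real n) + ?l)) * (4 * ln (real n))"
    using W S l0 by (intro mult_mono) auto
  then have "real ((m + K + 3) * (1 + floorlog 2 n)) \<le> 16 * ((sqrt (real n) + ?l) * ln (real n))"
    unfolding of_nat_mult by (simp add: algebra_simps)
  then show ?thesis by (simp only: of_nat_mult of_nat_numeral power_one_right mult.assoc)
qed

lemma main_prog_implements_within_bound:
  "implements_within main_prog 12 \<epsilon> m sbar s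
    (576 * (sqrt (real n) + log (1 + \<epsilon>) (real n)) * ln (real n) ^ 1)"
  using main_prog_implements memory_bound unfolding implements_within_def Let_def by (meson order_trans)

end

theorem theorem4:
  shows "(\<forall>(\<epsilon>::real) (n::nat) (m::nat) (sbar::'a list) (s::'a list).
            0 < \<epsilon> \<and> \<epsilon> \<le> 1 \<and> 1 \<le> n \<and> n = m ^ 2 \<and> length sbar = n \<and> length s = n \<and>
            (sbar \<noteq> s \<or> (1 - \<epsilon>) ^ m * real n \<le> real (f_val \<epsilon> (K_max \<epsilon> n))) \<longrightarrow>
            real (alg_output \<epsilon> m sbar s) \<ge> (1 - \<epsilon>) ^ m * real (lcs sbar s))
       \<and> (\<exists>(P::com) (d::nat) (C::real) (c::nat).
            \<forall>(\<epsilon>::real) (n::nat) (m::nat) (sbar::'a list) (s::'a list).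
              0 < \<epsilon> \<and> 2 \<le> n \<and> n = m ^ 2 \<and> length sbar = n \<and> length s = n \<longrightarrow>
              implements_within P d \<epsilon> m sbar s
                (C * (sqrt (real n) + log (1 + \<epsilon>) (real n)) * ln (real n) ^ c))"
proof (intro conjI allI impI)
  fix \<epsilon> :: real and n m :: nat and sbar s :: "'a list"
  assume "0 < \<epsilon> \<and> \<epsilon> \<le> 1 \<and> 1 \<le> n \<and> n = m ^ 2 \<and> length sbar = n \<and> length s = n \<and>
    (sbar \<noteq> s \<or> (1 - \<epsilon>) ^ m * real n \<le> real (f_val \<epsilon> (K_max \<epsilon> n)))"
  then show "(1 - \<epsilon>) ^ m * real (lcs sbar s) \<le> real (alg_output \<epsilon> m sbar s)"
    using alg_output_approx by blast
next
  \<comment> \<open>The same program and constants serve all \<open>\<epsilon>\<close> and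
    \<open>n\<close>; what depends on them is read from arrays 0 to 3.\<close>
  have "implements_within main_prog 12 \<epsilon> m sbar s
      (576 * (sqrt (real n) + log (1 + \<epsilon>) (real n)) * ln (real n) ^ 1)"
    if "0 < \<epsilon> \<and> 2 \<le> n \<and> n = m ^ 2 \<and> length sbar = n \<and> length s = n"
    for \<epsilon> n m and sbar s :: "'a list"
  proof -
    interpret lcs_run \<epsilon> n m sbar s using that by unfold_locales auto
    show ?thesis by (rule main_prog_implements_within_bound)
  qed
  then show "\<exists>(P::com) (d::nat) (C::real) (c::nat).
      \<forall>(\<epsilon>::real) (n::nat) (m::nat) (sbar::'a list) (s::'a list).
        0 < \<epsilon> \<and> 2 \<le> n \<and> n = m ^ 2 \<and> length sbar = n \<and> length s = n \<longrightarrow>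
        implements_within P d \<epsilon> m sbar s
          (C * (sqrt (real n) + log (1 + \<epsilon>) (real n)) * ln (real n) ^ c)"
    by blast
qed

end
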